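(* Let $k$ be a positive integer with $k \equiv 0 \pmod 4$, let $x$ be a positive integer with $x \neq 2$, let $u = kx+1$, and let $g \geq 3$ be odd. Then there exists a $k$-ARCS of $K_u \times K_g$.
   Context: For graphs $G,H$, the tensor product $G \times H$ has vertex set $V(G)\times V(H)$, with $(g_1,h_1)$ adjacent to $(g_2,h_2)$ iff $g_1g_2 \in E(G)$ and $h_1h_2 \in E(H)$. $K_n$ is the complete graph on $n$ vertices. $K_u \times K_g$ is regarded as a $u$-partite graph with partite sets $V_i = \{i\}\times V(K_g)$, $i=1,\dots,u$. A partial $C_k$-factor of $K_u \times K_g$ is a subgraph which, for some $i$, is a spanning subgraph of $(K_u \times K_g)\setminus V_i$ all of whose components are cycles of length $k$. A $k$-ARCS of $K_u \times K_g$ is a partition of its edge set into partial $C_k$-factors. *)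

theory Defs
  imports Main "HOL-Library.Disjoint_Sets"
begin

datatype 'a graph = Graph (verts: "'a set") (edges: "'a set set")

definition simple_graph :: "'a graph \<Rightarrow> bool" where
  "simple_graph G \<longleftrightarrow> (\<forall>e\<in>edges G. e \<subseteq> verts G \<and> card e = 2)"

definition complete_graph :: "nat \<Rightarrow> nat graph" where
  "complete_graph n = Graph {1..n} {e. e \<subseteq> {1..n} \<and> card e = 2}"

definition tensor_product :: "'a graph \<Rightarrow> 'b graph \<Rightarrow> ('a \<times> 'b) graph" where
  "tensor_product G H = Graph (verts G \<times> verts H)
     {{(g1, h1), (g2, h2)} | g1 h1 g2 h2. {g1, g2} \<in> edges G \<and> {h1, h2} \<in> edges H}"

definition delete_verts :: "'a graph \<Rightarrow> 'a set \<Rightarrow> 'a graph" where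
  "delete_verts G S = Graph (verts G - S) {e \<in> edges G. e \<inter> S = {}}"

definition induced_subgraph :: "'a graph \<Rightarrow> 'a set \<Rightarrow> 'a graph" where
  "induced_subgraph G S = Graph (verts G \<inter> S) {e \<in> edges G. e \<subseteq> S}"

definition subgraph :: "'a graph \<Rightarrow> 'a graph \<Rightarrow> bool" where
  "subgraph H G \<longleftrightarrow> simple_graph H \<and> verts H \<subseteq> verts G \<and> edges H \<subseteq> edges G"

definition spanning_subgraph :: "'a graph \<Rightarrow> 'a graph \<Rightarrow> bool" where
  "spanning_subgraph H G \<longleftrightarrow> subgraph H G \<and> verts H = verts G"

definition reachable :: "'a graph \<Rightarrow> 'a \<Rightarrow> 'a \<Rightarrow> bool" where
  "reachable G = (\<lambda>v w. {v, w} \<in> edges G)\<^sup>*\<^sup>*"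

definition components :: "'a graph \<Rightarrow> 'a graph set" where
  "components G = {induced_subgraph G {w. reachable G v w} | v. v \<in> verts G}"

definition is_cycle :: "nat \<Rightarrow> 'a graph \<Rightarrow> bool" where
  "is_cycle k C \<longleftrightarrow> k \<ge> 3 \<and>
     (\<exists>c. inj_on c {..<k} \<and> verts C = c ` {..<k} \<and>
          edges C = {{c i, c (Suc i mod k)} | i. i < k})"

definition partite_set :: "nat \<Rightarrow> nat \<Rightarrow> (nat \<times> nat) set" where
  "partite_set g i = {i} \<times> verts (complete_graph g)"

definition partial_cycle_factor :: "nat \<Rightarrow> nat \<Rightarrow> nat \<Rightarrow> (nat \<times> nat) graph \<Rightarrow> bool" where
  "partial_cycle_factor k u g H \<longleftrightarrow>
     (\<exists>i\<in>{1..u}.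
        spanning_subgraph H
          (delete_verts (tensor_product (complete_graph u) (complete_graph g)) (partite_set g i)) \<and>
        (\<forall>C\<in>components H. is_cycle k C))"

text \<open>A \<open>k\<close>-ARCS is given as the set of its partial factors; injectivity of \<open>edges\<close> excludes
  two different factors with the same edge set.\<close>

definition is_ARCS :: "nat \<Rightarrow> nat \<Rightarrow> nat \<Rightarrow> (nat \<times> nat) graph set \<Rightarrow> bool" where
  "is_ARCS k u g \<F> \<longleftrightarrow>
     (\<forall>H\<in>\<F>. partial_cycle_factor k u g H) \<and>
     inj_on edges \<F> \<and>
     partition_on (edges (tensor_product (complete_graph u) (complete_graph g))) (edges ` \<F>)"

end

theory Submission
  imports Defs
begin

text \<open>
  Call an orientation of an even cycle antidirected if sources and sinks alternate along it. It
  suffices to split the arcs of the complete symmetric digraph on \<open>u\<close> vertices into \<open>u\<close> sets, one for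
  each vertex \<open>v\<close>, such that the set of \<open>v\<close> consists of disjoint antidirected \<open>k\<close>-cycles covering all
  vertices but \<open>v\<close>. Indeed, identify \<open>V(K\<^sub>g)\<close> with \<open>\<int>/g\<close>; for each \<open>1 \<le> d \<le> (g - 1)/2\<close> an antidirected
  cycle lifts to \<open>g\<close> cycles of the same length, with sources at level \<open>s\<close> and sinks at level \<open>s + d\<close>.

  For \<open>x = 1\<close> such a splitting is obtained by rotating a zigzag cycle on \<open>\<int>/(k+1)\<close> whose differences
  are \<open>1, \<dots>, k\<close>. In general take a point at infinity and \<open>x\<close> groups of size \<open>k\<close>, and use the case
  \<open>x = 1\<close> on each group together with infinity. For the arcs between groups take an idempotent Latin
  square of order \<open>x\<close> (this needs \<open>x \<noteq> 2\<close>): each symbol \<open>s\<close> is a permutation of the other groups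
  without fixed points, so it has a proper 3-colouring. The columns of an orthogonal array with four
  rows, indexed by the colours, select in each group one half as sources and the other as sinks, and
  the complete bipartite graphs on halves split into Hamiltonian cycles.
\<close>

section \<open>Cycle factors and antidirected cycle factors\<close>

text \<open>Cycles given explicitly are easier to unite than \<open>components\<close>;
  \<open>cycle_factor_components\<close> leads back to these.\<close>

definition cycle_factor :: "nat \<Rightarrow> 'a set \<Rightarrow> 'a set set \<Rightarrow> bool" where
  "cycle_factor k W E \<longleftrightarrow> (\<exists>\<C>. (\<forall>C\<in>\<C>. is_cycle k C) \<and> disjoint_family_on verts \<C> \<and>
     W = (\<Union>C\<in>\<C>. verts C) \<and> E = (\<Union>C\<in>\<C>. edges C))"

lemma is_cycle_edge_verts:
  assumes "is_cycle k C" "e \<in> edges C"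
  shows "e \<subseteq> verts C"
proof -
  obtain c i where "verts C = c ` {..<k}" "e = {c i, c (Suc i mod k)}" "i < k"
    using assms by (auto simp: is_cycle_def)
  then show ?thesis by auto
qed

lemma is_cycle_connected:
  assumes C: "is_cycle k C" and sub: "edges C \<subseteq> edges G" and v: "v \<in> verts C" "w \<in> verts C"
  shows "reachable G v w"
proof -
  obtain c where k: "k \<ge> 3" and vs: "verts C = c ` {..<k}"
    and es: "edges C = {{c i, c (Suc i mod k)} | i. i < k}"
    using C by (auto simp: is_cycle_def)
  have step: "{c i, c (Suc i)} \<in> edges G" if "Suc i < k" for i
  proof -
    have "{c i, c (Suc i mod k)} \<in> edges C" using es that by auto
    then show ?thesis using sub that by auto
  qed
  have 1: "i < k \<Longrightarrow> reachable G (c 0) (c i)" for i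
  proof (induction i)
    case 0 then show ?case by (simp add: reachable_def)
  next
    case (Suc i)
    then show ?case using step[of i]
      by (auto simp: reachable_def intro: rtranclp.rtrancl_into_rtrancl)
  qed
  have 2: "i < k \<Longrightarrow> reachable G (c i) (c 0)" for i
  proof (induction i)
    case 0 then show ?case by (simp add: reachable_def)
  next
    case (Suc i)
    then show ?case using step[of i]
      by (auto simp: reachable_def insert_commute intro: converse_rtranclp_into_rtranclp)
  qed
  obtain i j where "v = c i" "i < k" "w = c j" "j < k" using v vs by auto
  then show ?thesis using 2[of i] 1[of j] unfolding reachable_def by simp
qed

text \<open>A walk never leaves the cycle on which it starts, since each edge lies in one of the
  cycles and these are vertex-disjoint; conversely a cycle is connected. So the component of a
  vertex is the cycle through it.\<close>

lemma cycle_factor_components: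
  assumes "cycle_factor k W E" "C \<in> components (Graph W E)"
  shows "is_cycle k C"
proof -
  let ?G = "Graph W E"
  obtain \<C> where cyc: "\<forall>C\<in>\<C>. is_cycle k C" and disj: "disjoint_family_on verts \<C>"
    and W: "W = (\<Union>C\<in>\<C>. verts C)" and E: "E = (\<Union>C\<in>\<C>. edges C)"
    using assms(1) by (auto simp: cycle_factor_def)
  obtain v where v: "v \<in> W" "C = induced_subgraph ?G {w. reachable ?G v w}"
    using assms(2) by (auto simp: components_def)
  obtain Z where Z: "Z \<in> \<C>" "v \<in> verts Z" using v W by auto
  have same: "Z' = Z" if "Z' \<in> \<C>" "y \<in> verts Z'" "y \<in> verts Z" for Z' y
    using disj that Z(1) by (auto simp: disjoint_family_on_def)
  have "reachable ?G v w \<Longrightarrow> w \<in> verts Z" for w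
    unfolding reachable_def
  proof (induction rule: rtranclp_induct)
    case base show ?case by (rule Z)
  next
    case (step y z)
    then obtain Z' where "Z' \<in> \<C>" "{y, z} \<in> edges Z'" using E by auto
    then show ?case using is_cycle_edge_verts[of k Z' "{y,z}"] cyc same[of Z' y] step by auto
  qed
  moreover have "reachable ?G v w" if "w \<in> verts Z" for w
    by (rule is_cycle_connected[of k Z]) (use cyc Z that E in auto)
  ultimately have R: "{w. reachable ?G v w} = verts Z" by auto
  have "W \<inter> verts Z = verts Z" using W Z by auto
  moreover have "{e \<in> E. e \<subseteq> verts Z} = edges Z"
  proof
    show "edges Z \<subseteq> {e \<in> E. e \<subseteq> verts Z}"
      using E Z cyc is_cycle_edge_verts by fastforce
    show "{e \<in> E. e \<subseteq> verts Z} \<subseteq> edges Z"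
    proof clarify
      fix e assume e: "e \<in> E" "e \<subseteq> verts Z"
      then obtain Z' where Z': "Z' \<in> \<C>" "e \<in> edges Z'" using E by auto
      then have "e \<subseteq> verts Z'" "e \<noteq> {}"
        using cyc is_cycle_edge_verts[of k Z' e] by (auto simp: is_cycle_def)
      then obtain y where "y \<in> e" "y \<in> verts Z'" by blast
      then show "e \<in> edges Z" using same[of Z' y] Z' e by auto
    qed
  qed
  ultimately have "C = Z" using v(2) R by (simp add: induced_subgraph_def)
  then show ?thesis using cyc Z by simp
qed

text \<open>\<open>partition_on\<close> forbids an empty block, so every factor must be shown to
  have an edge.\<close>

lemma cycle_factor_edges_nonempty:
  assumes "cycle_factor k W E" "W \<noteq> {}"
  shows "E \<noteq> {}"
proof -
  obtain \<C> where "\<forall>C\<in>\<C>. is_cycle k C" "W = (\<Union>C\<in>\<C>. verts C)" "E = (\<Union>C\<in>\<C>. edges C)"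
    using assms(1) by (auto simp: cycle_factor_def)
  moreover from this assms(2) obtain C where "C \<in> \<C>" by blast
  moreover have "edges D \<noteq> {}" if "is_cycle k D" for D :: "'a graph"
  proof -
    obtain c where "k \<ge> 3" "edges D = {{c i, c (Suc i mod k)} | i. i < k}"
      using \<open>is_cycle k D\<close> by (auto simp: is_cycle_def)
    then have "{c 0, c (Suc 0 mod k)} \<in> edges D" by fastforce
    then show ?thesis by blast
  qed
  ultimately show ?thesis by blast
qed

lemma cycle_factor_Un:
  assumes "cycle_factor k W E" "cycle_factor k W' E'" "W \<inter> W' = {}"
  shows "cycle_factor k (W \<union> W') (E \<union> E')"
proof -
  obtain A where A: "\<forall>C\<in>A. is_cycle k C" "disjoint_family_on verts A"
    "W = (\<Union>C\<in>A. verts C)" "E = (\<Union>C\<in>A. edges C)"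
    using assms(1) by (auto simp: cycle_factor_def)
  obtain B where B: "\<forall>C\<in>B. is_cycle k C" "disjoint_family_on verts B"
    "W' = (\<Union>C\<in>B. verts C)" "E' = (\<Union>C\<in>B. edges C)"
    using assms(2) by (auto simp: cycle_factor_def)
  have "disjoint_family_on verts (A \<union> B)"
    unfolding disjoint_family_on_def
  proof (intro ballI impI)
    have sub: "C \<in> A \<Longrightarrow> verts C \<subseteq> W" "C \<in> B \<Longrightarrow> verts C \<subseteq> W'" for C
      using A(3) B(3) by auto
    fix C D assume "C \<in> A \<union> B" "D \<in> A \<union> B" "C \<noteq> D"
    then consider "C \<in> A" "D \<in> A" | "C \<in> B" "D \<in> B" | "C \<in> A" "D \<in> B" | "C \<in> B" "D \<in> A"
      by blast
    then show "verts C \<inter> verts D = {}"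
    proof cases
      case 1
      then show ?thesis using A(2) \<open>C \<noteq> D\<close> by (simp add: disjoint_family_on_def)
    next
      case 2
      then show ?thesis using B(2) \<open>C \<noteq> D\<close> by (simp add: disjoint_family_on_def)
    next
      case 3
      then show ?thesis using sub(1)[of C] sub(2)[of D] assms(3) by blast
    next
      case 4
      then show ?thesis using sub(2)[of C] sub(1)[of D] assms(3) by blast
    qed
  qed
  then show ?thesis unfolding cycle_factor_def
    using A B by (intro exI[of _ "A \<union> B"]) auto
qed

text \<open>The arcs of the antidirected cycle of length \<open>2 h\<close> with sources \<open>p\<close> and sinks \<open>q\<close>.\<close>

definition anti_arcs :: "nat \<Rightarrow> (nat \<Rightarrow> 'a) \<Rightarrow> (nat \<Rightarrow> 'a) \<Rightarrow> ('a \<times> 'a) set" where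
  "anti_arcs h p q = {(p r, q r) | r. r < h} \<union> {(p (Suc r mod h), q r) | r. r < h}"

text \<open>Built up one cycle at a time, so that images, unions and lifts follow by rule induction.
  The parameter \<open>h\<close> is half the cycle length.\<close>

inductive anti_factor :: "nat \<Rightarrow> 'a set \<Rightarrow> ('a \<times> 'a) set \<Rightarrow> bool" for h where
  empty: "anti_factor h {} {}"
| add_cycle: "\<lbrakk>inj_on p {..<h}; inj_on q {..<h}; p ` {..<h} \<inter> q ` {..<h} = {};
    (p ` {..<h} \<union> q ` {..<h}) \<inter> W = {}; anti_factor h W D\<rbrakk>
    \<Longrightarrow> anti_factor h (p ` {..<h} \<union> q ` {..<h} \<union> W) (anti_arcs h p q \<union> D)"

lemma anti_factor_cycle:
  assumes "inj_on p {..<h}" "inj_on q {..<h}" "p ` {..<h} \<inter> q ` {..<h} = {}"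
  shows "anti_factor h (p ` {..<h} \<union> q ` {..<h}) (anti_arcs h p q)"
  using add_cycle[OF assms _ empty] by simp

lemma anti_arcs_subset: "anti_arcs h p q \<subseteq> p ` {..<h} \<times> q ` {..<h}"
  by (auto simp: anti_arcs_def)

lemma anti_factor_arc:
  assumes "anti_factor h W D" "(a, b) \<in> D"
  shows "a \<in> W \<and> b \<in> W \<and> a \<noteq> b"
  using assms
proof (induction arbitrary: a b)
  case (add_cycle p q W D)
  show ?case
  proof (cases "(a, b) \<in> D")
    case True
    then show ?thesis using add_cycle.IH by simp
  next
    case False
    then have "(a, b) \<in> p ` {..<h} \<times> q ` {..<h}"
      using add_cycle.prems anti_arcs_subset[of h p q] by blast
    then show ?thesis using add_cycle.hyps(3) by blast
  qed
qed simp

lemma anti_factor_Un: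
  assumes "anti_factor h W D" "anti_factor h W' D'" "W \<inter> W' = {}"
  shows "anti_factor h (W \<union> W') (D \<union> D')"
  using assms
proof (induction)
  case (add_cycle p q W D)
  have "anti_factor h (p ` {..<h} \<union> q ` {..<h} \<union> (W \<union> W')) (anti_arcs h p q \<union> (D \<union> D'))"
    by (rule anti_factor.add_cycle) (use add_cycle in blast)+
  then show ?case by (simp add: Un_assoc)
qed simp

lemma anti_factor_UN:
  assumes "finite I" "\<And>i. i \<in> I \<Longrightarrow> anti_factor h (W i) (D i)" "disjoint_family_on W I"
  shows "anti_factor h (\<Union>i\<in>I. W i) (\<Union>i\<in>I. D i)"
  using assms
proof (induction I)
  case (insert i I)
  have "W i \<inter> (\<Union>i\<in>I. W i) = {}"
    using insert.prems(2) insert.hyps by (auto simp: disjoint_family_on_def)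
  moreover have "disjoint_family_on W I"
    using insert.prems(2) by (auto simp: disjoint_family_on_def)
  ultimately show ?case using insert by (auto intro: anti_factor_Un)
qed (simp add: anti_factor.empty)

lemma anti_factor_image:
  assumes "anti_factor h W D" "inj_on f W"
  shows "anti_factor h (f ` W) (map_prod f f ` D)"
  using assms
proof (induction)
  case (add_cycle p q W D)
  have arcs: "map_prod f f ` anti_arcs h p q = anti_arcs h (f \<circ> p) (f \<circ> q)"
    by (auto simp: anti_arcs_def image_iff)
  have inj: "inj_on f (p ` {..<h} \<union> q ` {..<h} \<union> W)" by fact
  have d1: "f ` p ` {..<h} \<inter> f ` q ` {..<h} = {}"
    using add_cycle.hyps(3) inj by (subst inj_on_image_Int[OF inj, symmetric]) auto
  have d2: "f ` (p ` {..<h} \<union> q ` {..<h}) \<inter> f ` W = {}"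
    using add_cycle.hyps(4) inj by (subst inj_on_image_Int[OF inj, symmetric]) auto
  have "anti_factor h ((f \<circ> p) ` {..<h} \<union> (f \<circ> q) ` {..<h} \<union> f ` W)
      (anti_arcs h (f \<circ> p) (f \<circ> q) \<union> map_prod f f ` D)"
  proof (rule anti_factor.add_cycle)
    show "inj_on (f \<circ> p) {..<h}" "inj_on (f \<circ> q) {..<h}"
      using add_cycle.hyps(1,2) inj by (auto intro!: comp_inj_on elim: inj_on_subset)
    show "anti_factor h (f ` W) (map_prod f f ` D)"
      using add_cycle.IH inj_on_subset[OF inj] by blast
  qed (use d1 d2 in \<open>auto simp: image_comp image_Un\<close>)
  then show ?case by (simp add: arcs image_Un image_comp)
qed (simp add: anti_factor.empty)

section \<open>Lifting antidirected cycles to undirected cycles on levels\<close>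

definition lift_arcs :: "'b set \<Rightarrow> ('b \<Rightarrow> 'b) \<Rightarrow> ('a \<times> 'a) set \<Rightarrow> ('a \<times> 'b) set set" where
  "lift_arcs S \<sigma> D = {{(a, s), (b, \<sigma> s)} | a b s. (a, b) \<in> D \<and> s \<in> S}"

text \<open>Sources and sinks alternate along an antidirected cycle, so all sources can sit on level
  \<open>s\<close> and all sinks on level \<open>t\<close>: the lift closes up after one round
  instead of climbing.\<close>

lemma lift_anti_cycle:
  assumes "inj_on p {..<h}" "inj_on q {..<h}" "p ` {..<h} \<inter> q ` {..<h} = {}" "h \<ge> 2"
  shows "is_cycle (2 * h) (Graph (p ` {..<h} \<times> {s} \<union> q ` {..<h} \<times> {t})
    {{(a, s), (b, t)} | a b. (a, b) \<in> anti_arcs h p q})"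
proof -
  \<comment> \<open>One round of the cycle: sources at even positions, sinks at odd ones.\<close>
  define c where "c i = (if even i then (p (i div 2), s) else (q (i div 2), t))" for i
  have ne: "p i \<noteq> q j" if "i < h" "j < h" for i j using assms(3) that by blast
  have c_even: "c (2 * r) = (p r, s)" and c_odd: "c (Suc (2 * r)) = (q r, t)" for r
    by (auto simp: c_def)
  have inj: "inj_on c {..<2 * h}"
  proof (rule inj_onI)
    fix i j assume "i \<in> {..<2 * h}" "j \<in> {..<2 * h}" "c i = c j"
    moreover from this have "i div 2 < h" "j div 2 < h" by auto
    ultimately have "even i = even j" "i div 2 = j div 2"
      using assms(1,2) ne[of "i div 2" "j div 2"] ne[of "j div 2" "i div 2"]
      by (auto simp: c_def inj_on_def split: if_splits)
    then show "i = j" by presburger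
  qed
  have vs: "c ` {..<2 * h} = p ` {..<h} \<times> {s} \<union> q ` {..<h} \<times> {t}"
  proof
    show "c ` {..<2 * h} \<subseteq> p ` {..<h} \<times> {s} \<union> q ` {..<h} \<times> {t}"
      by (auto simp: c_def)
    have "(p r, s) \<in> c ` {..<2 * h}" "(q r, t) \<in> c ` {..<2 * h}" if "r < h" for r
      using that by (auto simp: c_even[symmetric] c_odd[symmetric])
    then show "p ` {..<h} \<times> {s} \<union> q ` {..<h} \<times> {t} \<subseteq> c ` {..<2 * h}" by auto
  qed
  have e1: "{c (2 * r), c (Suc (2 * r) mod (2 * h))} = {(p r, s), (q r, t)}" if "r < h" for r
  proof -
    have "Suc (2 * r) mod (2 * h) = Suc (2 * r)" using that by simp
    then show ?thesis by (simp add: c_even c_odd)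
  qed
  have e2: "{c (Suc (2 * r)), c (Suc (Suc (2 * r)) mod (2 * h))} = {(p (Suc r mod h), s), (q r, t)}"
    for r
  proof -
    \<comment> \<open>The index \<open>h\<close> wraps to \<open>0\<close>, which joins the last
      sink to the first source.\<close>
    have "Suc (Suc (2 * r)) mod (2 * h) = 2 * (Suc r mod h)"
      by (metis mult_Suc_right mult_mod_right add_2_eq_Suc)
    then show ?thesis by (simp add: c_even c_odd insert_commute)
  qed
  have "{{(a, s), (b, t)} | a b. (a, b) \<in> anti_arcs h p q}
      = {{c i, c (Suc i mod (2 * h))} | i. i < 2 * h}" (is "?L = ?R")
  proof
    have "{(p r, s), (q r, t)} \<in> ?R" if "r < h" for r
      using e1[OF that] that by (intro CollectI exI[of _ "2 * r"]) auto
    moreover have "{(p (Suc r mod h), s), (q r, t)} \<in> ?R" if "r < h" for r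
      using e2[of r] that by (intro CollectI exI[of _ "Suc (2 * r)"]) auto
    ultimately show "?L \<subseteq> ?R" unfolding anti_arcs_def by blast
    show "?R \<subseteq> ?L"
    proof clarify
      fix i assume i: "i < 2 * h"
      define r where "r = i div 2"
      have r: "r < h" using i by (auto simp: r_def)
      have "i = 2 * r \<or> i = Suc (2 * r)" unfolding r_def by presburger
      then show "\<exists>a b. {c i, c (Suc i mod (2 * h))} = {(a, s), (b, t)} \<and> (a, b) \<in> anti_arcs h p q"
      proof
        assume "i = 2 * r"
        then show ?thesis using e1[OF r] r
          by (intro exI[of _ "p r"] exI[of _ "q r"]) (auto simp: anti_arcs_def)
      next
        assume "i = Suc (2 * r)"
        then show ?thesis using e2[of r] r
          by (intro exI[of _ "p (Suc r mod h)"] exI[of _ "q r"]) (auto simp: anti_arcs_def)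
      qed
    qed
  qed
  then show ?thesis unfolding is_cycle_def using assms(4) inj vs by (intro conjI exI[of _ c]) auto
qed

text \<open>Each cycle has one lift for every level of its sources. As \<open>\<sigma>\<close>
  permutes \<open>S\<close>, the lifts are disjoint and each sink too appears on every level
  once.\<close>

lemma lift_anti_factor:
  assumes "anti_factor h W D" "bij_betw \<sigma> S S" "h \<ge> 2"
  shows "cycle_factor (2 * h) (W \<times> S) (lift_arcs S \<sigma> D)"
  using assms(1)
proof (induction)
  case empty
  then show ?case by (auto simp: cycle_factor_def lift_arcs_def disjoint_family_on_def intro!: exI[of _ "{}"])
next
  case (add_cycle p q W D)
  let ?C = "\<lambda>s. Graph (p ` {..<h} \<times> {s} \<union> q ` {..<h} \<times> {\<sigma> s})
    {{(a, s), (b, \<sigma> s)} | a b. (a, b) \<in> anti_arcs h p q}"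
  have inj: "\<sigma> s = \<sigma> t \<Longrightarrow> s \<in> S \<Longrightarrow> t \<in> S \<Longrightarrow> s = t" for s t
    using assms(2) by (auto simp: bij_betw_def inj_on_def)
  have im: "\<sigma> ` S = S" using assms(2) by (auto simp: bij_betw_def)
  have "cycle_factor (2 * h) ((p ` {..<h} \<union> q ` {..<h}) \<times> S) (lift_arcs S \<sigma> (anti_arcs h p q))"
    unfolding cycle_factor_def
  proof (intro exI[of _ "?C ` S"] conjI)
    show "\<forall>C\<in>?C ` S. is_cycle (2 * h) C"
    proof
      fix C assume "C \<in> ?C ` S"
      then obtain s where "C = ?C s" by blast
      then show "is_cycle (2 * h) C"
        by (simp only:) (rule lift_anti_cycle[OF add_cycle.hyps(1-3) assms(3)])
    qed
    show "disjoint_family_on verts (?C ` S)"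
      unfolding disjoint_family_on_def
    proof (intro ballI impI)
      fix C D assume "C \<in> ?C ` S" "D \<in> ?C ` S" "C \<noteq> D"
      then obtain s t where "C = ?C s" "D = ?C t" "s \<in> S" "t \<in> S" "s \<noteq> t" by blast
      then show "verts C \<inter> verts D = {}"
        using inj[of s t] add_cycle.hyps(3) by (simp only: graph.sel) blast
    qed
    have "(\<Union>s\<in>S. q ` {..<h} \<times> {\<sigma> s}) = q ` {..<h} \<times> \<sigma> ` S" by auto
    moreover have "(\<Union>C\<in>?C ` S. verts C) = p ` {..<h} \<times> S \<union> (\<Union>s\<in>S. q ` {..<h} \<times> {\<sigma> s})"
      by auto
    ultimately show "(p ` {..<h} \<union> q ` {..<h}) \<times> S = (\<Union>C\<in>?C ` S. verts C)"
      by (simp add: im Sigma_Un_distrib1)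
    show "lift_arcs S \<sigma> (anti_arcs h p q) = (\<Union>C\<in>?C ` S. edges C)"
      by (auto simp: lift_arcs_def)
  qed
  then have "cycle_factor (2 * h) ((p ` {..<h} \<union> q ` {..<h}) \<times> S \<union> W \<times> S)
      (lift_arcs S \<sigma> (anti_arcs h p q) \<union> lift_arcs S \<sigma> D)"
    by (rule cycle_factor_Un) (use add_cycle in auto)
  moreover have "lift_arcs S \<sigma> (anti_arcs h p q) \<union> lift_arcs S \<sigma> D
      = lift_arcs S \<sigma> (anti_arcs h p q \<union> D)"
    by (auto simp: lift_arcs_def)
  ultimately show ?case by (simp add: Sigma_Un_distrib1)
qed

text \<open>A near-resolvable decomposition of the complete symmetric digraph on \<open>V\<close>
  into antidirected cycles of length \<open>2 h\<close>; each factor is labelled by the vertex it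
  misses.\<close>

definition near_system :: "nat \<Rightarrow> 'a set \<Rightarrow> ('a \<Rightarrow> ('a \<times> 'a) set) \<Rightarrow> bool" where
  "near_system h V F \<longleftrightarrow> (\<forall>v\<in>V. anti_factor h (V - {v}) (F v)) \<and>
     (\<forall>a\<in>V. \<forall>b\<in>V. a \<noteq> b \<longrightarrow> (\<exists>!v. v \<in> V \<and> (a, b) \<in> F v))"

text \<open>Only the size of the vertex set matters, so constructions may use residues or a point at
  infinity.\<close>

lemma near_system_transport:
  assumes "near_system h V F" "bij_betw f V V'"
  shows "\<exists>F'. near_system h V' F'"
proof -
  define g where "g = the_inv_into V f"
  have inj: "inj_on f V" and im: "f ` V = V'" using assms(2) by (auto simp: bij_betw_def)
  have g: "g w \<in> V" "f (g w) = w" if "w \<in> V'" for w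
    using that inj im unfolding g_def by (auto simp: the_inv_into_into f_the_inv_into_f)
  have gf: "g (f v) = v" if "v \<in> V" for v
    using that inj unfolding g_def by (simp add: the_inv_into_f_f)
  have sub: "a \<in> V \<and> b \<in> V" if "v \<in> V" "(a, b) \<in> F v" for a b v
    using that assms(1) anti_factor_arc[of h "V - {v}" "F v" a b] by (simp add: near_system_def)
  define F' where "F' w = map_prod f f ` F (g w)" for w
  have mem: "(a, b) \<in> F' w \<longleftrightarrow> (g a, g b) \<in> F (g w)" if "a \<in> V'" "b \<in> V'" "w \<in> V'" for a b w
  proof
    assume "(a, b) \<in> F' w"
    then obtain a' b' where "a = f a'" "b = f b'" "(a', b') \<in> F (g w)"
      by (auto simp: F'_def)
    then show "(g a, g b) \<in> F (g w)" using sub[of "g w" a' b'] g that gf by simp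
  next
    assume "(g a, g b) \<in> F (g w)"
    then have "map_prod f f (g a, g b) \<in> F' w" unfolding F'_def by (rule imageI)
    then show "(a, b) \<in> F' w" using g that by simp
  qed
  have "near_system h V' F'" unfolding near_system_def
  proof (intro conjI ballI impI)
    fix w assume w: "w \<in> V'"
    have "anti_factor h (f ` (V - {g w})) (F' w)"
      unfolding F'_def
      by (rule anti_factor_image) (use assms(1) g w inj in \<open>auto simp: near_system_def elim: inj_on_subset\<close>)
    moreover have "f ` (V - {g w}) = V' - {w}"
      using inj_on_image_set_diff[OF inj, of V "{g w}"] g[OF w] im by auto
    ultimately show "anti_factor h (V' - {w}) (F' w)" by simp
  next
    fix a b assume ab: "a \<in> V'" "b \<in> V'" "a \<noteq> b"
    then have "g a \<noteq> g b" using g by metis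
    then obtain v where v: "v \<in> V" "(g a, g b) \<in> F v" 
      and u: "\<And>v'. v' \<in> V \<Longrightarrow> (g a, g b) \<in> F v' \<Longrightarrow> v' = v"
      using assms(1) g ab unfolding near_system_def by metis
    show "\<exists>!w. w \<in> V' \<and> (a, b) \<in> F' w"
    proof (rule ex1I[of _ "f v"])
      show "f v \<in> V' \<and> (a, b) \<in> F' (f v)" using v im ab mem gf by auto
      fix w assume "w \<in> V' \<and> (a, b) \<in> F' w"
      then show "w = f v" using u[of "g w"] mem ab g by metis
    qed
  qed
  then show ?thesis by blast
qed

section \<open>Three-colourings and idempotent Latin squares\<close>

text \<open>Greedy colouring: a vertex \<open>y\<close> added to \<open>X\<close> has at most two
  neighbours, its image and its preimage under \<open>\<pi>\<close>. The condition
  \<open>\<pi> a \<in> X\<close> makes the claim inductive, as subsets need not be closed under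
  \<open>\<pi>\<close>.\<close>

lemma proper_three_colouring:
  assumes "finite X" "inj_on \<pi> X" "\<And>a. a \<in> X \<Longrightarrow> \<pi> a \<noteq> a"
  shows "\<exists>col :: 'a \<Rightarrow> nat. (\<forall>a. col a < 3) \<and> (\<forall>a\<in>X. \<pi> a \<in> X \<longrightarrow> col a \<noteq> col (\<pi> a))"
  using assms
proof (induction X)
  case empty
  show ?case by (intro exI[of _ "\<lambda>_. 0"]) simp
next
  case (insert y X)
  have "\<exists>col :: 'a \<Rightarrow> nat. (\<forall>a. col a < 3) \<and> (\<forall>a\<in>X. \<pi> a \<in> X \<longrightarrow> col a \<noteq> col (\<pi> a))"
    by (rule insert.IH) (use insert.prems in auto)
  then obtain col :: "'a \<Rightarrow> nat" where col: "\<And>a. col a < 3"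
    "\<And>a. a \<in> X \<Longrightarrow> \<pi> a \<in> X \<Longrightarrow> col a \<noteq> col (\<pi> a)"
    by blast
  \<comment> \<open>The preimage of \<open>y\<close>; if there is none, \<open>z\<close> is
    arbitrary and avoiding \<open>col z\<close> does no harm.\<close>
  define z where "z = the_inv_into (insert y X) \<pi> y"
  have z: "a = z" if "a \<in> X" "\<pi> a = y" for a
    using that insert.prems(1) the_inv_into_f_f[of \<pi> "insert y X" a] by (auto simp: z_def)
  have "\<exists>c::nat. c < 3 \<and> c \<noteq> i \<and> c \<noteq> j" for i j by presburger
  then obtain c where c: "c < 3" "c \<noteq> col z" "c \<noteq> col (\<pi> y)" by blast
  have "(col(y := c)) a \<noteq> (col(y := c)) (\<pi> a)" if "a \<in> insert y X" "\<pi> a \<in> insert y X" for a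
    using that c col(2)[of a] z[of a] insert.prems(2)[of a] insert.hyps by auto
  then show ?case using c(1) col(1) by (intro exI[of _ "col(y := c)"]) simp
qed

text \<open>The square \<open>2 b - a\<close> modulo \<open>n\<close>. Each claim reduces to a
  congruence for a difference of two residues or for its double, and 2 is invertible modulo an odd
  \<open>n\<close>. The summand \<open>n\<close> keeps the subtraction from being truncated.\<close>

lemma idempotent_latin_square_odd:
  fixes n :: nat
  assumes "odd n"
  defines "f \<equiv> \<lambda>a b. (2 * b + n - a) mod n"
  shows "a < n \<Longrightarrow> b < n \<Longrightarrow> f a b < n"
    and "a < n \<Longrightarrow> b < n \<Longrightarrow> f a b = a \<Longrightarrow> a = b"
    and "a < n \<Longrightarrow> b < n \<Longrightarrow> f a b = b \<Longrightarrow> a = b"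
    and "a < n \<Longrightarrow> b < n \<Longrightarrow> c < n \<Longrightarrow> f a b = f a c \<Longrightarrow> b = c"
    and "a < n \<Longrightarrow> b < n \<Longrightarrow> c < n \<Longrightarrow> f a c = f b c \<Longrightarrow> a = b"
proof -
  have f: "\<exists>q::int. int (f a b) = 2 * int b - int a + q * int n" if "a < n" for a b
  proof -
    have "int (f a b) = (2 * int b + int n - int a) mod int n"
      using that by (simp add: f_def zmod_int of_nat_diff)
    also have "\<dots> = (2 * int b + int n - int a)
        - int n * ((2 * int b + int n - int a) div int n)"
      by (simp add: minus_mult_div_eq_mod)
    finally show ?thesis
      by (intro exI[of _ "1 - (2 * int b + int n - int a) div int n"]) (simp add: algebra_simps)
  qed
  have small: "i = j" if "i < n" "j < n" "int i - int j = q * int n" for i j q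
  proof -
    have "\<bar>q * int n\<bar> < int n" using that by linarith
    moreover have "1 * int n \<le> \<bar>q\<bar> * int n" if "q \<noteq> 0"
      by (rule mult_right_mono) (use that in auto)
    ultimately have "q = 0" by (auto simp: abs_mult)
    then show ?thesis using that by simp
  qed
  have small2: "i = j" if "i < n" "j < n" "2 * (int i - int j) = q * int n" for i j q
  proof -
    \<comment> \<open>As \<open>n\<close> is odd, \<open>q\<close> is even and the factor 2
      cancels.\<close>
    have "even (q * int n)" by (metis dvd_triv_left that(3))
    then obtain r where "q = 2 * r" using assms by auto
    then show ?thesis using small[of i j r] that by simp
  qed
  show "a < n \<Longrightarrow> b < n \<Longrightarrow> f a b < n" by (simp add: f_def)
  show "a = b" if h: "a < n" "b < n" "f a b = a"
  proof -
    obtain q where "int (f a b) = 2 * int b - int a + q * int n" using f[OF h(1)] by blast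
    then show ?thesis using small2[of a b q] h by simp
  qed
  show "a = b" if h: "a < n" "b < n" "f a b = b"
  proof -
    obtain q where "int (f a b) = 2 * int b - int a + q * int n" using f[OF h(1)] by blast
    then show ?thesis using small[of a b q] h by simp
  qed
  show "b = c" if h: "a < n" "b < n" "c < n" "f a b = f a c"
  proof -
    obtain q r where "int (f a b) = 2 * int b - int a + q * int n"
      "int (f a c) = 2 * int c - int a + r * int n" using f[OF h(1)] by blast
    then have "2 * (int b - int c) = (r - q) * int n" using h by (simp add: algebra_simps)
    then show ?thesis using small2 h by blast
  qed
  show "a = b" if h: "a < n" "b < n" "c < n" "f a c = f b c"
  proof -
    obtain q r where "int (f a c) = 2 * int c - int a + q * int n"
      "int (f b c) = 2 * int c - int b + r * int n" using f[OF h(1)] f[OF h(2)] by blast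
    then have "int a - int b = (q - r) * int n" using h by (simp add: algebra_simps)
    then show ?thesis using small h by blast
  qed
qed

text \<open>Diagonal entries are ignored: they are understood to be \<open>f a a = a\<close>.\<close>

definition idempotent_latin :: "nat \<Rightarrow> (nat \<Rightarrow> nat \<Rightarrow> nat) \<Rightarrow> bool" where
  "idempotent_latin x f \<longleftrightarrow>
     (\<forall>a<x. \<forall>b<x. a \<noteq> b \<longrightarrow> f a b < x \<and> f a b \<noteq> a \<and> f a b \<noteq> b) \<and>
     (\<forall>a<x. inj_on (f a) ({..<x} - {a})) \<and>
     (\<forall>b<x. inj_on (\<lambda>a. f a b) ({..<x} - {b}))"

text \<open>For even order the square \<open>2 b - a\<close> modulo \<open>n = x - 1\<close> is prolonged along the transversal
  \<open>b = a + 1\<close>, whose entries are \<open>a + 2\<close>.\<close>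

lemma idempotent_latin_exists:
  assumes "x > 0" "x \<noteq> 2"
  shows "\<exists>f. idempotent_latin x f"
proof (cases "odd x")
  case True
  note sq = idempotent_latin_square_odd[OF True]
  show ?thesis
    unfolding idempotent_latin_def
  proof (rule exI[of _ "\<lambda>a b. (2 * b + x - a) mod x"], intro conjI allI impI inj_onI)
    fix a b assume "a < x" "b < x" "a \<noteq> b"
    then show "(2 * b + x - a) mod x < x" "(2 * b + x - a) mod x \<noteq> a" "(2 * b + x - a) mod x \<noteq> b"
      using sq(1-3)[of a b] by blast+
  qed (use sq(4,5) in blast)+
next
  case False
  define n where "n = x - 1"
  have n: "odd n" "n \<ge> 3" "x = Suc n" using assms False unfolding n_def by presburger+
  define f where "f a b = (2 * b + n - a) mod n" for a b
  note sq = idempotent_latin_square_odd[OF n(1), folded f_def]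
  define s where "s i j = (if i + j < n then i + j else i + j - n)" for i j
  have s: "s i j < n" "i > 0 \<Longrightarrow> s i j \<noteq> j" "s i j = s i k \<Longrightarrow> j = k"
    if "i < n" "j < n" "k < n" for i j k
    using that n(2) unfolding s_def by (auto split: if_splits)
  have fs: "f a (s 1 a) = s 2 a" if "a < n" for a
  proof (cases "a + 1 = n")
    case True
    then show ?thesis using n(2) by (auto simp: f_def s_def)
  next
    case False
    then have "2 * s 1 a + n - a = (a + 2) + n" using that by (simp add: s_def)
    then have "f a (s 1 a) = (a + 2) mod n" by (simp only: f_def mod_add_self2)
    then show ?thesis using False that by (auto simp: s_def le_mod_geq)
  qed
  \<comment> \<open>The new symbol \<open>n\<close> replaces the transversal. The displaced entry
    goes to the end of its row, where it is \<open>a + 2\<close>, and to the end of its column,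
    where it is \<open>b + 1\<close>. The corner \<open>F n n\<close> lies on the ignored
    diagonal.\<close>
  define F where "F a b = (if a = n then s 1 b else if b = n then s 2 a
    else if b = s 1 a then n else f a b)" for a b
  have row: "f a b \<noteq> s 2 a" if "a < n" "b < n" "b \<noteq> s 1 a" for a b
    using sq(4)[of a b "s 1 a"] fs[of a] s(1)[of 1 a] that n(2) by auto
  have col: "f a b \<noteq> s 1 b" if "a < n" "b < n" "b \<noteq> s 1 a" for a b
  proof -
    \<comment> \<open>The row in which the transversal meets column \<open>b\<close>; its displaced
      entry is \<open>s 1 b\<close>.\<close>
    define a' where "a' = (if b = 0 then n - 1 else b - 1)"
    have "a' < n" "s 1 a' = b" "s 2 a' = s 1 b" using that n(2) by (auto simp: a'_def s_def)
    then show ?thesis using sq(5)[of a a' b] fs[of a'] that by auto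
  qed
  \<comment> \<open>Shifts by 1 and 2 have no fixed points because \<open>n \<ge> 3\<close>; for
    order 2, where \<open>n\<close> would be 1, this fails.\<close>
  have s1: "s 1 a < n" "s 1 a \<noteq> a" "s 2 a < n" "s 2 a \<noteq> a" if "a < n" for a
    using s[of 1 a] s[of 2 a] that n(2) by auto
  have s1_inj: "s 1 a = s 1 b \<Longrightarrow> a = b" and s2_inj: "s 2 a = s 2 b \<Longrightarrow> a = b" 
    if "a < n" "b < n" for a b
    using s(3)[of 1 a b] s(3)[of 2 a b] that n(2) by auto
  have lt: "a < x \<longleftrightarrow> a < n \<or> a = n" for a using n(3) by auto
  have "idempotent_latin x F"
    unfolding idempotent_latin_def
  proof (intro conjI allI impI inj_onI)
    fix a b assume "a < x" "b < x" "a \<noteq> b"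
    then show "F a b < x" "F a b \<noteq> a" "F a b \<noteq> b"
      using s1[of a] s1[of b] sq(1-3)[of a b] by (auto simp: F_def lt)
  next
    fix a b c assume "a < x" "b \<in> {..<x} - {a}" "c \<in> {..<x} - {a}" "F a b = F a c"
    then show "b = c"
      using s1[of a] s1[of b] s1[of c] s1_inj[of b c] sq(1)[of a b] sq(1)[of a c] sq(4)[of a b c]
        row[of a b] row[of a c]
      by (auto simp: F_def lt split: if_splits)
  next
    fix c a b assume *: "c < x" "a \<in> {..<x} - {c}" "b \<in> {..<x} - {c}" "F a c = F b c"
    have inf: "F a c \<noteq> s 1 c" if "a < n" "c < n" for a
      using col[of a c] s1(1)[of c] that by (auto simp: F_def)
    consider "c = n" "a < n" "b < n" | "c < n" "a = n" "b < n" | "c < n" "a < n" "b = n"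
      | "a = b" | "c < n" "a < n" "b < n" using * by (auto simp: lt)
    then show "a = b"
    proof cases
      case 1
      then show ?thesis using *(4) s2_inj[of a b] by (simp add: F_def)
    next
      case 2
      then show ?thesis using *(4) inf[of b] by (simp add: F_def)
    next
      case 3
      then show ?thesis using *(4) inf[of a] by (simp add: F_def)
    next
      case 5
      have F: "F d c = (if c = s 1 d then n else f d c)" "f d c \<noteq> n" if "d < n" for d
        using that 5(1) sq(1)[of d c] by (auto simp: F_def)
      show ?thesis
      proof (cases "c = s 1 a \<or> c = s 1 b")
        case True
        then have "c = s 1 a \<and> c = s 1 b" using *(4) F 5 by metis
        then show ?thesis using s1_inj 5 by metis
      next
        case False
        then show ?thesis using *(4) F 5 sq(5)[of a b c] by simp
      qed
    qed
  qed
  then show ?thesis by blast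
qed

section \<open>The case of one group\<close>

text \<open>Addition modulo \<open>n\<close> on \<open>{..<n}\<close>, as a conditional so that case
  splits and linear arithmetic apply.\<close>

definition rotate_by :: "nat \<Rightarrow> nat \<Rightarrow> nat \<Rightarrow> nat" where
  "rotate_by n t y = (if y + t < n then y + t else y + t - n)"

lemma rotate_by_less: "t < n \<Longrightarrow> y < n \<Longrightarrow> rotate_by n t y < n"
  by (auto simp: rotate_by_def)

lemma bij_betw_rotate_by:
  assumes "t < n"
  shows "bij_betw (rotate_by n t) {..<n} {..<n}"
proof -
  have "inj_on (rotate_by n t) {..<n}"
    by (rule inj_onI) (auto simp: rotate_by_def split: if_splits)
  moreover have "rotate_by n t ` {..<n} \<subseteq> {..<n}" using assms by (auto simp: rotate_by_less)
  ultimately show ?thesis by (simp add: bij_betw_def endo_inj_surj)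
qed

text \<open>In the zigzag \<open>0, 4 m, 1, 4 m - 1, ...\<close> the sources go up and the sinks go
  down. Skipping the vertex \<open>3 m\<close> skips the difference \<open>2 m\<close>, which the
  closing arc from \<open>0\<close> to \<open>2 m\<close> supplies.\<close>

definition zigzag_sink :: "nat \<Rightarrow> nat \<Rightarrow> nat" where
  "zigzag_sink m j = (if j < m then 4 * m - j else 4 * m - j - 1)"

text \<open>Apart from the closing arc, the sum of both ends is \<open>4 m\<close> or differs from
  it by 1, which turns questions about differences into linear arithmetic. With sum
  \<open>4 m\<close>, the source \<open>m\<close> is excluded because its sink would be the skipped
  vertex \<open>3 m\<close>.\<close>

lemma zigzag_arcs:
  assumes "m \<ge> 1"
  shows "(a, b) \<in> anti_arcs (2 * m) (\<lambda>j. j) (zigzag_sink m) \<longleftrightarrow>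
    a < 2 * m \<and> a \<noteq> m \<and> a + b = 4 * m \<or> m \<le> a \<and> a < 2 * m \<and> a + b + 1 = 4 * m \<or>
    1 \<le> a \<and> a \<le> m \<and> a + b = 4 * m + 1 \<or> a = 0 \<and> b = 2 * m" (is "?L \<longleftrightarrow> ?R")
proof
  assume ?L
  then obtain j where j: "j < 2 * m" "b = zigzag_sink m j" "a = j \<or> a = Suc j mod (2 * m)"
    by (auto simp: anti_arcs_def)
  show ?R
  proof (cases "a = j")
    case True
    then show ?thesis using j assms by (auto simp: zigzag_sink_def)
  next
    case False
    then have "a = (if Suc j = 2 * m then 0 else Suc j)" using j by auto
    then show ?thesis using j(1,2) assms by (auto simp: zigzag_sink_def)
  qed
next
  have A: "(j, zigzag_sink m j) \<in> anti_arcs (2 * m) (\<lambda>j. j) (zigzag_sink m)"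
    "(Suc j mod (2 * m), zigzag_sink m j) \<in> anti_arcs (2 * m) (\<lambda>j. j) (zigzag_sink m)"
    if "j < 2 * m" for j
    using that by (auto simp: anti_arcs_def)
  assume ?R
  then show ?L
  proof (elim disjE conjE)
    assume a: "a < 2 * m" "a \<noteq> m" "a + b = 4 * m"
    show ?L
    proof (cases "a < m")
      case True
      then have "zigzag_sink m a = b" using a by (simp add: zigzag_sink_def)
      then show ?thesis using A(1)[of a] a by simp
    next
      case False
      then have "zigzag_sink m (a - 1) = b" "Suc (a - 1) mod (2 * m) = a" "a - 1 < 2 * m"
        using a by (auto simp: zigzag_sink_def)
      then show ?thesis using A(2)[of "a - 1"] by simp
    qed
  next
    assume a: "m \<le> a" "a < 2 * m" "a + b + 1 = 4 * m"
    then have "zigzag_sink m a = b" by (simp add: zigzag_sink_def)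
    then show ?L using A(1)[of a] a by simp
  next
    assume a: "1 \<le> a" "a \<le> m" "a + b = 4 * m + 1"
    then have "zigzag_sink m (a - 1) = b" "Suc (a - 1) mod (2 * m) = a" "a - 1 < 2 * m"
      using assms by (auto simp: zigzag_sink_def)
    then show ?L using A(2)[of "a - 1"] by simp
  next
    assume "a = 0" "b = 2 * m"
    then have "zigzag_sink m (2 * m - 1) = b" "Suc (2 * m - 1) mod (2 * m) = a" "2 * m - 1 < 2 * m"
      using assms by (auto simp: zigzag_sink_def)
    then show ?L using A(2)[of "2 * m - 1"] by simp
  qed
qed

lemma zigzag_factor:
  assumes "m \<ge> 1"
  shows "anti_factor (2 * m) ({..<4 * m + 1} - {3 * m}) (anti_arcs (2 * m) (\<lambda>j. j) (zigzag_sink m))"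
proof -
  have "zigzag_sink m ` {..<2 * m} = {2 * m..4 * m} - {3 * m}"
  proof
    show "zigzag_sink m ` {..<2 * m} \<subseteq> {2 * m..4 * m} - {3 * m}"
      by (auto simp: zigzag_sink_def)
    show "{2 * m..4 * m} - {3 * m} \<subseteq> zigzag_sink m ` {..<2 * m}"
    proof
      fix b assume b: "b \<in> {2 * m..4 * m} - {3 * m}"
      define j where "j = (if b > 3 * m then 4 * m - b else 4 * m - b - 1)"
      have "b = zigzag_sink m j" "j < 2 * m"
        using b assms by (auto simp: zigzag_sink_def j_def)
      then show "b \<in> zigzag_sink m ` {..<2 * m}" by blast
    qed
  qed
  moreover have "{..<4 * m + 1} - {3 * m} = (\<lambda>j. j) ` {..<2 * m} \<union> ({2 * m..4 * m} - {3 * m})"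
    using assms by auto
  ultimately have V: "{..<4 * m + 1} - {3 * m} = (\<lambda>j. j) ` {..<2 * m} \<union> zigzag_sink m ` {..<2 * m}"
    by simp
  show ?thesis
    unfolding V
  proof (rule anti_factor_cycle)
    show "inj_on (zigzag_sink m) {..<2 * m}"
      by (rule inj_onI) (auto simp: zigzag_sink_def split: if_splits)
  qed (auto simp: zigzag_sink_def)
qed

text \<open>The zigzag is a starter: each nonzero residue modulo \<open>4 m + 1\<close> is the
  difference of exactly one of its arcs. The difference of \<open>(a, b)\<close> thus selects the
  arc, and \<open>a\<close> then selects the rotation.\<close>

lemma near_system_base:
  assumes m: "m \<ge> 1"
  shows "\<exists>F. near_system (2 * m) {..<4 * m + 1} F"
proof -
  define u where "u = 4 * m + 1"
  define A where "A = anti_arcs (2 * m) (\<lambda>j. j) (zigzag_sink m)"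
  \<comment> \<open>The rotation that moves the uncovered vertex \<open>3 m\<close> to
    \<open>v\<close>; \<open>m + 1\<close> is \<open>u - 3 m\<close>.\<close>
  define \<tau> where "\<tau> v = (if v \<ge> 3 * m then v - 3 * m else v + m + 1)" for v
  define F where "F v = map_prod (rotate_by u (\<tau> v)) (rotate_by u (\<tau> v)) ` A" for v
  have \<tau>: "\<tau> v < u" "rotate_by u (\<tau> v) (3 * m) = v" if "v < u" for v
    using that by (auto simp: \<tau>_def u_def rotate_by_def)
  \<comment> \<open>Zigzag arcs point upwards, so their differences need no reduction modulo
    \<open>u\<close>.\<close>
  have A_less: "c < e \<and> e < u" if "(c, e) \<in> A" for c e
    using that m unfolding A_def zigzag_arcs[OF m] u_def by auto
  have A_ex: "\<exists>c. (c, c + d) \<in> A" if "1 \<le> d" "d < u" for d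
  proof -
    \<comment> \<open>The closing arc has difference \<open>2 m\<close>; the others are sorted by
      parity and by the side of the gap.\<close>
    consider j where "d = 2 * j" "d > 2 * m" | "d = 2 * m" | j where "d = 2 * j" "d < 2 * m"
      | j where "d = 2 * j + 1" "d > 2 * m" | j where "d = 2 * j + 1" "d < 2 * m"
      by (metis even_iff_mod_2_eq_zero linorder_neqE_nat oddE evenE dvd_triv_left)
    then show ?thesis
    proof cases
      case 1
      then show ?thesis using that unfolding A_def zigzag_arcs[OF m] u_def
        by (intro exI[of _ "2 * m - j"]) auto
    next
      case 2
      then show ?thesis unfolding A_def zigzag_arcs[OF m] by (intro exI[of _ 0]) auto
    next
      case 3
      then show ?thesis using that unfolding A_def zigzag_arcs[OF m] u_def
        by (intro exI[of _ "2 * m - j"]) auto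
    next
      case 4
      then show ?thesis using that unfolding A_def zigzag_arcs[OF m] u_def
        by (intro exI[of _ "2 * m - j"]) auto
    next
      case 5
      then show ?thesis using that unfolding A_def zigzag_arcs[OF m] u_def
        by (intro exI[of _ "2 * m - j - 1"]) auto
    qed
  qed
  \<comment> \<open>Recovers the source of a zigzag arc from its difference, which gives
    uniqueness.\<close>
  define \<psi> where "\<psi> d = (if d = 2 * m then 0 else if odd d \<and> d < 2 * m then 2 * m - d div 2 - 1
    else 2 * m - d div 2)" for d
  have A_\<psi>: "c = \<psi> (e - c)" if "(c, e) \<in> A" for c e
    using that unfolding A_def zigzag_arcs[OF m]
  proof (elim disjE conjE)
    assume "c < 2 * m" "c \<noteq> m" "c + e = 4 * m"
    moreover from this have "e - c = 2 * (2 * m - c)" by simp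
    ultimately show ?thesis by (auto simp: \<psi>_def)
  next
    assume "m \<le> c" "c < 2 * m" "c + e + 1 = 4 * m"
    moreover from this have "e - c = 2 * (2 * m - c - 1) + 1" by simp
    ultimately show ?thesis by (auto simp: \<psi>_def)
  next
    assume "1 \<le> c" "c \<le> m" "c + e = 4 * m + 1"
    moreover from this have "e - c = 2 * (2 * m - c) + 1" by simp
    ultimately show ?thesis by (auto simp: \<psi>_def)
  qed (simp add: \<psi>_def)
  have "near_system (2 * m) {..<u} F"
    unfolding near_system_def
  proof (intro conjI ballI impI)
    fix v assume v: "v \<in> {..<u}"
    then have bij: "bij_betw (rotate_by u (\<tau> v)) {..<u} {..<u}" by (simp add: bij_betw_rotate_by \<tau>)
    then have inj: "inj_on (rotate_by u (\<tau> v)) {..<u}" and im: "rotate_by u (\<tau> v) ` {..<u} = {..<u}"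
      by (auto simp: bij_betw_def)
    have "anti_factor (2 * m) (rotate_by u (\<tau> v) ` ({..<u} - {3 * m})) (F v)"
      unfolding F_def A_def u_def
      by (rule anti_factor_image[OF zigzag_factor[OF m]])
        (use inj in \<open>auto simp: u_def elim: inj_on_subset\<close>)
    moreover have "rotate_by u (\<tau> v) ` ({..<u} - {3 * m}) = {..<u} - {v}"
      using inj_on_image_set_diff[OF inj, of "{..<u}" "{3 * m}"] im \<tau>(2)[of v] v
      by (simp add: u_def)
    ultimately show "anti_factor (2 * m) ({..<u} - {v}) (F v)" by simp
  next
    fix a b assume ab: "a \<in> {..<u}" "b \<in> {..<u}" "a \<noteq> b"
    define d where "d = (if a < b then b - a else b + u - a)"
    have d: "1 \<le> d" "d < u" using ab by (auto simp: d_def)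
    then obtain c where c: "(c, c + d) \<in> A" using A_ex by blast
    have cd: "c + d < u" using A_less[OF c] by simp
    \<comment> \<open>The rotation taking the source \<open>c\<close> to \<open>a\<close>, and hence
      the arc to \<open>(a, b)\<close>.\<close>
    define t where "t = (if c \<le> a then a - c else a + u - c)"
    define v where "v = rotate_by u t (3 * m)"
    have t: "t < u" using cd ab by (auto simp: t_def)
    have v: "v < u" "\<tau> v = t" using t by (auto simp: v_def u_def rotate_by_def \<tau>_def)
    have rot: "rotate_by u t c = a" "rotate_by u t (c + d) = b"
      using cd ab d(1) by (auto simp: rotate_by_def t_def d_def)
    show "\<exists>!v. v \<in> {..<u} \<and> (a, b) \<in> F v"
    proof (rule ex1I[of _ v])
      have "map_prod (rotate_by u t) (rotate_by u t) (c, c + d) \<in> F v"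
        unfolding F_def v(2) using c by (rule imageI)
      then show "v \<in> {..<u} \<and> (a, b) \<in> F v" using v rot by simp
    next
      fix w assume w: "w \<in> {..<u} \<and> (a, b) \<in> F w"
      then obtain c' e' where c': "(c', e') \<in> A" "a = rotate_by u (\<tau> w) c'" "b = rotate_by u (\<tau> w) e'"
        by (auto simp: F_def)
      have \<tau>w: "\<tau> w < u" using w \<tau> by simp
      have "c' < e'" "e' < u" using A_less c' by auto
      then have "e' - c' = d" using c'(2,3) \<tau>w
        by (auto simp: rotate_by_def d_def split: if_splits)
      then have "c' = c" using A_\<psi>[OF c'(1)] A_\<psi>[OF c] by simp
      then have "\<tau> w = t" using c'(2) \<tau>w \<open>c' < e'\<close> \<open>e' < u\<close>
        by (auto simp: rotate_by_def t_def split: if_splits)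
      then have "rotate_by u (\<tau> w) (3 * m) = v" by (simp add: v_def)
      then show "w = v" using \<tau>(2) w by simp
    qed
  qed
  then show ?thesis unfolding u_def by blast
qed

section \<open>Arcs between groups\<close>

text \<open>The differences \<open>j - i\<close> modulo \<open>2 m\<close> split the complete
  bipartite graph into perfect matchings; those of differences \<open>2 e\<close> and
  \<open>2 e + 1\<close> form a Hamiltonian cycle, where \<open>e = n div 2\<close>. The parity of
  \<open>n\<close> stays free for the orthogonal array.\<close>

lemma bipartite_cycle_arcs:
  assumes "n < 2 * m"
  shows "((a', i), (b', j)) \<in> anti_arcs (2 * m) (\<lambda>r. (a, r))
      (\<lambda>r. (b, rotate_by (2 * m) (2 * (n div 2) + 1) r)) \<longleftrightarrow>
    a' = a \<and> b' = b \<and> i < 2 * m \<and> j < 2 * m \<and>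
    (if i \<le> j then j - i else j + 2 * m - i) div 2 = n div 2" (is "?L \<longleftrightarrow> ?R")
proof
  define e where "e = n div 2"
  have e: "e < m" using assms by (simp add: e_def less_mult_imp_div_less mult.commute)
  assume ?L
  then obtain r where r: "r < 2 * m" "a' = a" "b' = b" "i = r \<or> i = Suc r mod (2 * m)"
    "j = rotate_by (2 * m) (2 * e + 1) r"
    by (auto simp: anti_arcs_def e_def)
  have j: "j < 2 * m" using r e by (auto intro!: rotate_by_less)
  have "(if i \<le> j then j - i else j + 2 * m - i) = (if i = r then 2 * e + 1 else 2 * e)"
  proof (cases "i = r")
    case True
    then show ?thesis using r e by (auto simp: rotate_by_def)
  next
    case False
    then have "i = (if Suc r = 2 * m then 0 else Suc r)" using r by auto
    then show ?thesis using r(1,5) e False by (auto simp: rotate_by_def)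
  qed
  moreover have "i < 2 * m" using r by auto
  ultimately show ?R using r j unfolding e_def by auto
next
  define e where "e = n div 2"
  define d where "d = (if i \<le> j then j - i else j + 2 * m - i)"
  have e: "e < m" using assms by (simp add: e_def less_mult_imp_div_less mult.commute)
  assume R: ?R
  then have "d div 2 = e" by (simp add: d_def e_def)
  then consider "d = 2 * e + 1" | "d = 2 * e" by linarith
  then show ?L
  proof cases
    case 1
    then have "j = rotate_by (2 * m) (2 * e + 1) i"
      using R e by (auto simp: d_def rotate_by_def split: if_splits)
    then show ?thesis using R by (auto simp: anti_arcs_def e_def)
  next
    case 2
    \<comment> \<open>Difference \<open>2 e\<close> belongs to the arcs whose source is the cyclic
      successor of \<open>r\<close>.\<close>
    define r where "r = (if i = 0 then 2 * m - 1 else i - 1)"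
    have "j = rotate_by (2 * m) (2 * e + 1) r" "r < 2 * m" "Suc r mod (2 * m) = i"
      using R e 2 by (auto simp: d_def r_def rotate_by_def split: if_splits)
    then show ?thesis using R unfolding anti_arcs_def e_def by blast
  qed
qed

text \<open>The three columns of the orthogonal array of strength two on the rows \<open>(h, odd n)\<close>:
  any two of them take each pair of values exactly once.\<close>

definition oa_column :: "nat \<Rightarrow> bool \<times> nat \<Rightarrow> bool" where
  "oa_column c t = (if c = 0 then fst t else if c = 1 then odd (snd t) else fst t \<noteq> odd (snd t))"

text \<open>The columns are two bits and their exclusive or, so any two determine both bits, and the
  parity together with \<open>snd t div 2\<close> gives \<open>snd t\<close>. It is applied to the
  distinct colours of \<open>a\<close> and \<open>\<pi> a\<close>.\<close>

lemma oa_column_unique: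
  assumes "c < 3" "c' < 3" "c \<noteq> c'"
  shows "\<exists>!t. oa_column c t = e \<and> oa_column c' t = e' \<and> snd t div 2 = k"
proof -
  define h where "h = (if c = 0 then e else if c' = 0 then e' else e \<noteq> e')"
  define o' where "o' = (if c = 1 then e else if c' = 1 then e' else e \<noteq> e')"
  have *: "oa_column c t = e \<and> oa_column c' t = e' \<longleftrightarrow> fst t = h \<and> odd (snd t) = o'" for t
    using assms by (auto simp: oa_column_def h_def o'_def)
  show ?thesis
  proof (rule ex1I[of _ "(h, 2 * k + of_bool o')"])
    show "oa_column c (h, 2 * k + of_bool o') = e \<and> oa_column c' (h, 2 * k + of_bool o') = e' \<and>
        snd (h, 2 * k + of_bool o') div 2 = k"
      using *[of "(h, 2 * k + of_bool o')"] by auto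
    fix t assume "oa_column c t = e \<and> oa_column c' t = e' \<and> snd t div 2 = k"
    then have "fst t = h" "odd (snd t) = o'" "snd t div 2 = k" using *[of t] by blast+
    then have "snd t = 2 * k + of_bool o'" by (auto elim!: oddE)
    then show "t = (h, 2 * k + of_bool o')" using \<open>fst t = h\<close> by (simp add: prod_eq_iff)
  qed
qed

text \<open>Blowing up a fixed-point-free permutation: the arc from \<open>a\<close> to \<open>\<pi> a\<close> becomes a Hamiltonian
  cycle from one half of the group of \<open>a\<close> to one half of the group of \<open>\<pi> a\<close>. Every group is a source
  with the half prescribed by its colour and a sink with the other half.\<close>

lemma permutation_blow_up:
  fixes \<pi> :: "'a \<Rightarrow> 'a" and m :: nat
  assumes X: "finite X" and bij: "bij_betw \<pi> X X" and fpf: "\<forall>a\<in>X. \<pi> a \<noteq> a"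
  defines "P \<equiv> (UNIV :: bool set) \<times> {..<2 * m}"
  shows "\<exists>G. (\<forall>t\<in>P. anti_factor (2 * m) (X \<times> P) (G t)) \<and>
    (\<forall>t\<in>P. \<forall>a p b q. ((a, p), (b, q)) \<in> G t \<longrightarrow> a \<in> X \<and> b = \<pi> a) \<and>
    (\<forall>a\<in>X. \<forall>p\<in>P. \<forall>q\<in>P. \<exists>!t. t \<in> P \<and> ((a, p), (\<pi> a, q)) \<in> G t)"
proof -
  have inj: "inj_on \<pi> X" and im: "\<pi> ` X = X" using bij by (auto simp: bij_betw_def)
  obtain col :: "'a \<Rightarrow> nat" where col: "\<And>a. col a < 3" "\<And>a. a \<in> X \<Longrightarrow> col a \<noteq> col (\<pi> a)"
    using proper_three_colouring[OF X inj] fpf im by blast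
  define \<sigma> where "\<sigma> a t = oa_column (col a) t" for a t
  \<comment> \<open>The choice of the Hamiltonian cycle depends on \<open>snd t div 2\<close> only;
    \<open>fst t\<close> and the parity of \<open>snd t\<close> are the bits that choose the
    halves.\<close>
  define sh where "sh t = rotate_by (2 * m) (2 * (snd t div 2) + 1)" for t :: "bool \<times> nat"
  define p where "p t a r = (a, \<sigma> a t, r)" for t a and r :: nat
  define q where "q t a r = (\<pi> a, \<not> \<sigma> (\<pi> a) t, sh t r)" for t a and r :: nat
  define G where "G t = (\<Union>a\<in>X. anti_arcs (2 * m) (p t a) (q t a))" for t
  have p_im: "p t a ` {..<2 * m} = {a} \<times> {\<sigma> a t} \<times> {..<2 * m}" for t a
    by (auto simp: p_def)
  have sh: "bij_betw (sh t) {..<2 * m} {..<2 * m}" if "t \<in> P" for t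
  proof -
    have "snd t < 2 * m" using that by (auto simp: P_def)
    then have "2 * (snd t div 2) + 1 < 2 * m" by presburger
    then show ?thesis unfolding sh_def by (rule bij_betw_rotate_by)
  qed
  have q_im: "q t a ` {..<2 * m} = {\<pi> a} \<times> {\<not> \<sigma> (\<pi> a) t} \<times> {..<2 * m}" if "t \<in> P" for t a
  proof -
    have "q t a ` {..<2 * m} = {\<pi> a} \<times> {\<not> \<sigma> (\<pi> a) t} \<times> sh t ` {..<2 * m}"
      by (auto simp: q_def)
    then show ?thesis using sh[OF that] by (simp add: bij_betw_def)
  qed
  have factor: "anti_factor (2 * m) (X \<times> P) (G t)" if t: "t \<in> P" for t
  proof -
    let ?W = "\<lambda>a. p t a ` {..<2 * m} \<union> q t a ` {..<2 * m}"
    have "anti_factor (2 * m) (\<Union>a\<in>X. ?W a) (G t)"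
      unfolding G_def
    proof (rule anti_factor_UN[OF X])
      fix a assume a: "a \<in> X"
      have "inj_on (sh t) {..<2 * m}" using sh[OF t] by (simp add: bij_betw_def)
      then show "anti_factor (2 * m) (?W a) (anti_arcs (2 * m) (p t a) (q t a))"
        using bspec[OF fpf a] by (intro anti_factor_cycle) (auto simp: p_def q_def inj_on_def)
    next
      \<comment> \<open>A group occurs once as source group and once as sink group, with opposite
        halves.\<close>
      show "disjoint_family_on ?W X"
        unfolding disjoint_family_on_def p_im q_im[OF t]
        using inj by (auto simp: inj_on_def)
    qed
    moreover have "(\<Union>a\<in>X. ?W a) = X \<times> P"
    proof -
      have "(\<Union>a\<in>X. ?W a) = (\<Union>a\<in>X. {a} \<times> {\<sigma> a t} \<times> {..<2 * m}) \<union>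
          (\<Union>b\<in>\<pi> ` X. {b} \<times> {\<not> \<sigma> b t} \<times> {..<2 * m})"
        unfolding p_im q_im[OF t] by blast
      also have "\<dots> = X \<times> P" unfolding im P_def by auto
      finally show ?thesis .
    qed
    ultimately show ?thesis by simp
  qed
  have mem: "((a, e, i), (b, e', j)) \<in> G t \<longleftrightarrow>
      a \<in> X \<and> b = \<pi> a \<and> e = \<sigma> a t \<and> e' = (\<not> \<sigma> (\<pi> a) t) \<and> i < 2 * m \<and> j < 2 * m \<and>
      (if i \<le> j then j - i else j + 2 * m - i) div 2 = snd t div 2"
    if t: "t \<in> P" for a b e e' i j t
  proof -
    define D where "D \<longleftrightarrow> i < 2 * m \<and> j < 2 * m \<and>
      (if i \<le> j then j - i else j + 2 * m - i) div 2 = snd t div 2"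
    have n: "snd t < 2 * m" using t by (auto simp: P_def)
    \<comment> \<open>After regrouping, the pair of group and half plays the role of a side in
      \<open>bipartite_cycle_arcs\<close>.\<close>
    have 1: "((a, e, i), (b, e', j)) \<in> anti_arcs (2 * m) (p t c) (q t c) \<longleftrightarrow>
      (((a, e), i), ((b, e'), j)) \<in> anti_arcs (2 * m) (\<lambda>r. ((c, \<sigma> c t), r)) (\<lambda>r. ((\<pi> c, \<not> \<sigma> (\<pi> c) t),
        rotate_by (2 * m) (2 * (snd t div 2) + 1) r))" for c
      by (auto simp: anti_arcs_def p_def q_def sh_def)
    have 2: "((a, e, i), (b, e', j)) \<in> anti_arcs (2 * m) (p t c) (q t c) \<longleftrightarrow> (a, e) = (c, \<sigma> c t) \<and> (b, e') = (\<pi> c, \<not> \<sigma> (\<pi> c) t) \<and> D" for c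
      unfolding 1 D_def by (rule bipartite_cycle_arcs[OF n])
    have "((a, e, i), (b, e', j)) \<in> G t \<longleftrightarrow>
        (\<exists>c\<in>X. (a, e) = (c, \<sigma> c t) \<and> (b, e') = (\<pi> c, \<not> \<sigma> (\<pi> c) t) \<and> D)"
      unfolding G_def UN_iff 2 ..
    then show ?thesis unfolding D_def[symmetric] by blast
  qed
  have "\<exists>!t. t \<in> P \<and> ((a, p), (\<pi> a, q)) \<in> G t" if a: "a \<in> X" and pq: "p \<in> P" "q \<in> P" for a p q
  proof -
    obtain e i e' j where p: "p = (e, i)" "i < 2 * m" and q: "q = (e', j)" "j < 2 * m"
      using pq by (auto simp: P_def)
    define d where "d = (if i \<le> j then j - i else j + 2 * m - i) div 2"
    have d: "d < m" using p q by (auto simp: d_def)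
    have in_P: "t \<in> P" if "snd t div 2 = d" for t
      using that d by (cases t) (auto simp: P_def)
    \<comment> \<open>The half of \<open>p\<close> is read in the column of \<open>a\<close>; that
      of \<open>q\<close> is negated, as sinks use the half complementary to the sources.\<close>
    obtain t where t: "oa_column (col a) t = e \<and> oa_column (col (\<pi> a)) t = (\<not> e') \<and> snd t div 2 = d"
      and u: "\<And>t'. oa_column (col a) t' = e \<and> oa_column (col (\<pi> a)) t' = (\<not> e') \<and> snd t' div 2 = d \<Longrightarrow> t' = t"
      using oa_column_unique[OF col(1) col(1) col(2)[OF a], of e "\<not> e'" d] by blast
    show ?thesis
    proof (rule ex1I[of _ t])
      have "t \<in> P" using in_P t by blast
      then show "t \<in> P \<and> ((a, p), (\<pi> a, q)) \<in> G t"
        using t a p q unfolding p(1) q(1) by (subst mem) (auto simp: \<sigma>_def d_def)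
      fix t' assume t': "t' \<in> P \<and> ((a, p), (\<pi> a, q)) \<in> G t'"
      then have "((a, e, i), (\<pi> a, e', j)) \<in> G t'" using p q by simp
      then have "e = \<sigma> a t'" "e' = (\<not> \<sigma> (\<pi> a) t')" "snd t' div 2 = d"
        using t' mem[of t' a e i "\<pi> a" e' j] unfolding d_def by auto
      then show "t' = t" by (intro u) (simp add: \<sigma>_def)
    qed
  qed
  moreover have "a \<in> X \<and> b = \<pi> a" if "t \<in> P" "((a, p), (b, q)) \<in> G t" for t a p b q
    using mem[OF that(1), of a "fst p" "snd p" b "fst q" "snd q"] that(2) by simp
  ultimately show ?thesis using factor by blast
qed

text \<open>By idempotency row and column \<open>s\<close> carry \<open>s\<close> on the diagonal,
  so the off-diagonal cells with symbol \<open>s\<close> form a fixed-point-free permutation of the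
  other groups. Its blow-up uses all arcs from group \<open>a\<close> to group \<open>b\<close> with
  \<open>f a b = s\<close> and leaves group \<open>s\<close> as a hole.\<close>

lemma idempotent_latin_frame:
  fixes m :: nat
  assumes lat: "idempotent_latin x f" and s: "s < x"
  defines "P \<equiv> (UNIV :: bool set) \<times> {..<2 * m}"
  shows "\<exists>G. (\<forall>t\<in>P. anti_factor (2 * m) (({..<x} - {s}) \<times> P) (G t)) \<and>
    (\<forall>t\<in>P. \<forall>a p b q. ((a, p), (b, q)) \<in> G t \<longrightarrow> a \<noteq> b \<and> f a b = s) \<and>
    (\<forall>a<x. \<forall>b<x. a \<noteq> b \<longrightarrow> f a b = s \<longrightarrow>
      (\<forall>p\<in>P. \<forall>q\<in>P. \<exists>!t. t \<in> P \<and> ((a, p), (b, q)) \<in> G t))"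
proof -
  have range: "f a b < x" "f a b \<noteq> a" "f a b \<noteq> b" if "a < x" "b < x" "a \<noteq> b" for a b
    using lat that by (auto simp: idempotent_latin_def)
  have row: "inj_on (f a) ({..<x} - {a})" and col: "inj_on (\<lambda>b. f b a) ({..<x} - {a})" if "a < x" for a
    using lat that by (auto simp: idempotent_latin_def)
  have "\<exists>b. b < x \<and> b \<noteq> a \<and> f a b = s" if a: "a \<in> {..<x} - {s}" for a
  proof -
    \<comment> \<open>An injective self-map of a finite set is onto, so \<open>s\<close> occurs in
      row \<open>a\<close>.\<close>
    have "f a ` ({..<x} - {a}) = {..<x} - {a}"
      using a range row[of a] by (intro endo_inj_surj) auto
    then have "s \<in> f a ` ({..<x} - {a})" using s a by auto
    then show ?thesis by auto
  qed
  then obtain \<pi> where \<pi>: "\<And>a. a \<in> {..<x} - {s} \<Longrightarrow> \<pi> a < x \<and> \<pi> a \<noteq> a \<and> f a (\<pi> a) = s"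
    by metis
  have \<pi>_eq: "b = \<pi> a" if "a < x" "b < x" "a \<noteq> b" "f a b = s" for a b
  proof -
    have "a \<in> {..<x} - {s}" using that range[of a b] by auto
    then show ?thesis using \<pi>[of a] row[of a] that by (auto simp: inj_on_def)
  qed
  have "inj_on \<pi> ({..<x} - {s})"
  proof (rule inj_onI)
    fix a b assume *: "a \<in> {..<x} - {s}" "b \<in> {..<x} - {s}" "\<pi> a = \<pi> b"
    then show "a = b" using \<pi>[of a] \<pi>[of b] col[of "\<pi> a"] by (auto simp: inj_on_def)
  qed
  moreover have "\<pi> a \<in> {..<x} - {s}" if "a \<in> {..<x} - {s}" for a
    using \<pi>[OF that] range[of a "\<pi> a"] that by auto
  then have "\<pi> ` ({..<x} - {s}) \<subseteq> {..<x} - {s}" by blast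
  ultimately have bij: "bij_betw \<pi> ({..<x} - {s}) ({..<x} - {s})"
    unfolding bij_betw_def by (simp add: endo_inj_surj)
  have fin: "finite ({..<x} - {s})" by simp
  have fpf: "\<forall>a\<in>{..<x} - {s}. \<pi> a \<noteq> a" using \<pi> by blast
  obtain G where G: "\<forall>t\<in>P. anti_factor (2 * m) (({..<x} - {s}) \<times> P) (G t)"
    and arc: "\<forall>t\<in>P. \<forall>a p b q. ((a, p), (b, q)) \<in> G t \<longrightarrow> a \<in> {..<x} - {s} \<and> b = \<pi> a"
    and ex1: "\<forall>a\<in>{..<x} - {s}. \<forall>p\<in>P. \<forall>q\<in>P. \<exists>!t. t \<in> P \<and> ((a, p), (\<pi> a, q)) \<in> G t"
    using permutation_blow_up[OF fin bij fpf, of m, folded P_def]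
    by (elim exE conjE) (rule that)
  show ?thesis
  proof (intro exI[of _ G] conjI G ballI allI impI)
    fix t a p b q assume "t \<in> P" "((a, p), (b, q)) \<in> G t"
    then have "a \<in> {..<x} - {s}" "b = \<pi> a" using arc by blast+
    then show "a \<noteq> b" "f a b = s" using \<pi>[of a] by auto
  next
    fix a b p q assume *: "a < x" "b < x" "a \<noteq> b" "f a b = s" and pq: "p \<in> P" "q \<in> P"
    then have "a \<in> {..<x} - {s}" "b = \<pi> a" using \<pi>_eq[of a b] range[of a b] by auto
    then show "\<exists>!t. t \<in> P \<and> ((a, p), (b, q)) \<in> G t" using ex1 pq by simp
  qed
qed

text \<open>\<open>P\<close> serves twice: as the points of a group and as the labels of the
  blown-up factors with a given hole. Hence each point \<open>(i, t)\<close> can be matched with the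
  factor \<open>t\<close> whose hole is group \<open>i\<close>.\<close>

lemma near_system_exists:
  assumes m: "m \<ge> 1" and x: "x > 0" "x \<noteq> 2"
  shows "\<exists>F. near_system (2 * m) {1..4 * m * x + 1} F"
proof -
  define P where "P = (UNIV :: bool set) \<times> {..<2 * m}"
  \<comment> \<open>\<open>None\<close> is the point at infinity, shared by all groups.\<close>
  define W where "W i = insert None (Some ` ({i} \<times> P))" for i :: nat
  define V where "V = insert None (Some ` ({..<x} \<times> P))"
  have P: "finite P" "card P = 4 * m" by (simp_all add: P_def card_cartesian_product)
  obtain f where lat: "idempotent_latin x f" using idempotent_latin_exists[OF x] by blast
  have range: "f a b < x" if "a < x" "b < x" "a \<noteq> b" for a b
    using lat that by (auto simp: idempotent_latin_def)
  have card_insert: "card (insert None (Some ` Q)) = card Q + 1" if "finite Q" for Q :: "(nat \<times> bool \<times> nat) set"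
    using that by (subst card_insert_disjoint) (auto simp: card_image)
  have "\<exists>B. near_system (2 * m) (W i) B" for i
  proof -
    have "card (W i) = card {..<4 * m + 1}"
      unfolding W_def using P by (subst card_insert) (auto simp: card_cartesian_product)
    moreover have "finite (W i)" using P by (simp add: W_def)
    ultimately obtain h where "bij_betw h {..<4 * m + 1} (W i)"
      using finite_same_card_bij[of "{..<4 * m + 1}" "W i"] by auto
    then show ?thesis using near_system_base[OF m] near_system_transport by blast
  qed
  then obtain B where B: "\<And>i. near_system (2 * m) (W i) (B i)" by metis
  define frame where "frame s G \<longleftrightarrow> (\<forall>t\<in>P. anti_factor (2 * m) (({..<x} - {s}) \<times> P) (G t)) \<and>
    (\<forall>t\<in>P. \<forall>a p b q. ((a, p), (b, q)) \<in> G t \<longrightarrow> a \<noteq> b \<and> f a b = s) \<and>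
    (\<forall>a<x. \<forall>b<x. a \<noteq> b \<longrightarrow> f a b = s \<longrightarrow>
      (\<forall>p\<in>P. \<forall>q\<in>P. \<exists>!t. t \<in> P \<and> ((a, p), (b, q)) \<in> G t))" for s G
  have "\<exists>G. frame s G" if "s < x" for s
    unfolding frame_def P_def by (rule idempotent_latin_frame[OF lat that])
  then obtain G where frame: "\<And>s. s < x \<Longrightarrow> frame s (G s)" by metis
  have G: "anti_factor (2 * m) (({..<x} - {s}) \<times> P) (G s t)" if "s < x" "t \<in> P" for s t
    using frame[OF that(1)] that(2) unfolding frame_def by blast
  have G_arc: "a \<noteq> b \<and> f a b = s" if "s < x" "t \<in> P" "((a, p), (b, q)) \<in> G s t" for s t a p b q
    using frame[OF that(1)] that(2,3) unfolding frame_def by blast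
  have G_ex1: "\<exists>!t. t \<in> P \<and> ((a, p), (b, q)) \<in> G s t"
    if "s < x" "a < x" "b < x" "a \<noteq> b" "f a b = s" "p \<in> P" "q \<in> P" for s a b p q
    using frame[OF that(1)] that(2-) unfolding frame_def by blast
  \<comment> \<open>A factor missing a point of group \<open>i\<close> takes \<open>B\<close> inside
    \<open>W i\<close> and fills the other groups with hole \<open>i\<close>; at infinity the
    factors of all groups missing \<open>None\<close> combine.\<close>
  define F where "F v = (case v of None \<Rightarrow> (\<Union>i<x. B i None)
    | Some (i, t) \<Rightarrow> B i (Some (i, t)) \<union> map_prod Some Some ` G i t)" for v
  have B_factor: "anti_factor (2 * m) (W i - {v}) (B i v)" if "v \<in> W i" for i v
    using B that by (auto simp: near_system_def)
  have B_ex1: "\<exists>!v. v \<in> W i \<and> (\<alpha>, \<beta>) \<in> B i v" if "\<alpha> \<in> W i" "\<beta> \<in> W i" "\<alpha> \<noteq> \<beta>" for i \<alpha> \<beta>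
    using B that by (auto simp: near_system_def)
  have B_arc: "\<alpha> \<in> W i \<and> \<beta> \<in> W i \<and> \<alpha> \<noteq> \<beta>" if "v \<in> W i" "(\<alpha>, \<beta>) \<in> B i v" for i v \<alpha> \<beta>
    using anti_factor_arc[OF B_factor[OF that(1)] that(2)] by blast
  \<comment> \<open>Distinct sets \<open>W i\<close> and \<open>W j\<close> share only
    \<open>None\<close>, so two points determine the group.\<close>
  have W_same: "i = j" if "\<alpha> \<in> W i" "\<beta> \<in> W i" "\<alpha> \<noteq> \<beta>" "\<alpha> \<in> W j" "\<beta> \<in> W j" for i j \<alpha> \<beta>
    using that by (auto simp: W_def)
  have arc_cases: "(\<exists>i<x. v \<in> W i \<and> (\<alpha>, \<beta>) \<in> B i v) \<or>
      (\<exists>s t a p b q. s < x \<and> t \<in> P \<and> v = Some (s, t) \<and> \<alpha> = Some (a, p) \<and> \<beta> = Some (b, q) \<and>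
        ((a, p), (b, q)) \<in> G s t)" if h: "v \<in> V" "(\<alpha>, \<beta>) \<in> F v" for v \<alpha> \<beta>
  proof (cases v)
    case None
    then show ?thesis using h(2) by (auto simp: F_def W_def)
  next
    case (Some it)
    then obtain i t where v: "v = Some (i, t)" "i < x" "t \<in> P" using h(1) by (auto simp: V_def)
    then have "(\<alpha>, \<beta>) \<in> B i v \<or> (\<alpha>, \<beta>) \<in> map_prod Some Some ` G i t"
      using h(2) by (auto simp: F_def)
    then show ?thesis
    proof
      assume "(\<alpha>, \<beta>) \<in> B i v"
      moreover have "v \<in> W i" using v by (auto simp: W_def)
      ultimately show ?thesis using v(2) by blast
    next
      assume "(\<alpha>, \<beta>) \<in> map_prod Some Some ` G i t"
      then obtain a p b q where "\<alpha> = Some (a, p)" "\<beta> = Some (b, q)" "((a, p), (b, q)) \<in> G i t"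
        by auto
      then show ?thesis using v by blast
    qed
  qed
  have "near_system (2 * m) V F"
    unfolding near_system_def
  proof (intro conjI ballI impI)
    fix v assume v: "v \<in> V"
    show "anti_factor (2 * m) (V - {v}) (F v)"
    proof (cases v)
      case None
      have "anti_factor (2 * m) (\<Union>i<x. W i - {None}) (\<Union>i<x. B i None)"
      proof (rule anti_factor_UN)
        show "disjoint_family_on (\<lambda>i. W i - {None}) {..<x}"
          by (auto simp: disjoint_family_on_def W_def)
        show "anti_factor (2 * m) (W i - {None}) (B i None)" for i
          by (rule B_factor) (simp add: W_def)
      qed simp
      moreover have "(\<Union>i<x. W i - {None}) = V - {None}" by (auto simp: W_def V_def)
      ultimately show ?thesis using None by (simp add: F_def)
    next
      case (Some it)
      then obtain i t where it: "v = Some (i, t)" "i < x" "t \<in> P" using v by (auto simp: V_def)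
      have "anti_factor (2 * m) ((W i - {v}) \<union> Some ` (({..<x} - {i}) \<times> P))
          (B i v \<union> map_prod Some Some ` G i t)"
        by (intro anti_factor_Un B_factor anti_factor_image G) (use it in \<open>auto simp: W_def\<close>)
      moreover have "(W i - {v}) \<union> Some ` (({..<x} - {i}) \<times> P) = V - {v}"
        using it by (auto simp: W_def V_def)
      ultimately show ?thesis using it by (simp add: F_def)
    qed
  next
    fix \<alpha> \<beta> assume ab: "\<alpha> \<in> V" "\<beta> \<in> V" "\<alpha> \<noteq> \<beta>"
    show "\<exists>!v. v \<in> V \<and> (\<alpha>, \<beta>) \<in> F v"
    \<comment> \<open>Arcs inside some \<open>W i\<close> can come only from \<open>B i\<close>, all
      others only from the Latin square.\<close>
    proof (cases "\<exists>i<x. \<alpha> \<in> W i \<and> \<beta> \<in> W i")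
      case True
      then obtain i where i: "i < x" "\<alpha> \<in> W i" "\<beta> \<in> W i" by blast
      then have ex1: "\<exists>!v. v \<in> W i \<and> (\<alpha>, \<beta>) \<in> B i v" using B_ex1 ab by blast
      have "v \<in> V \<and> (\<alpha>, \<beta>) \<in> F v \<longleftrightarrow> v \<in> W i \<and> (\<alpha>, \<beta>) \<in> B i v" for v
      proof
        assume v: "v \<in> V \<and> (\<alpha>, \<beta>) \<in> F v"
        then consider j where "j < x" "v \<in> W j" "(\<alpha>, \<beta>) \<in> B j v"
          | s t a p b q where "s < x" "t \<in> P" "\<alpha> = Some (a, p)" "\<beta> = Some (b, q)" "((a, p), (b, q)) \<in> G s t"
          using arc_cases by blast
        then show "v \<in> W i \<and> (\<alpha>, \<beta>) \<in> B i v"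
        proof cases
          case 1
          then have "j = i" using B_arc W_same i by blast
          then show ?thesis using 1 by blast
        next
          case 2
          then have "a \<noteq> b" using G_arc by blast
          then show ?thesis using i 2 by (auto simp: W_def)
        qed
      next
        assume v: "v \<in> W i \<and> (\<alpha>, \<beta>) \<in> B i v"
        then show "v \<in> V \<and> (\<alpha>, \<beta>) \<in> F v"
          using i(1) by (auto simp: W_def V_def F_def)
      qed
      then show ?thesis using ex1 by simp
    next
      case False
      obtain a p b q where \<alpha>: "\<alpha> = Some (a, p)" "a < x" "p \<in> P" and \<beta>: "\<beta> = Some (b, q)" "b < x" "q \<in> P"
      proof -
        have W_ex: "\<exists>i<x. \<gamma> \<in> W i" if "\<gamma> \<in> V" for \<gamma>
          using that x(1) by (auto simp: V_def W_def)
        have "None \<in> W i" for i by (simp add: W_def)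
        then have "\<alpha> \<noteq> None" "\<beta> \<noteq> None" using W_ex[OF ab(1)] W_ex[OF ab(2)] False by metis+
        then have "\<alpha> \<in> Some ` ({..<x} \<times> P)" "\<beta> \<in> Some ` ({..<x} \<times> P)" using ab by (auto simp: V_def)
        then show thesis using that by blast
      qed
      have "a \<noteq> b" using False \<alpha> \<beta> by (auto simp: W_def)
      define s where "s = f a b"
      have s: "s < x" using range \<alpha> \<beta> \<open>a \<noteq> b\<close> by (simp add: s_def)
      obtain t where t: "t \<in> P" "((a, p), (b, q)) \<in> G s t"
        and t_unique: "\<And>t'. t' \<in> P \<Longrightarrow> ((a, p), (b, q)) \<in> G s t' \<Longrightarrow> t' = t"
        using G_ex1[OF s \<alpha>(2) \<beta>(2) \<open>a \<noteq> b\<close> _ \<alpha>(3) \<beta>(3)] unfolding s_def by blast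
      show ?thesis
      proof (rule ex1I[of _ "Some (s, t)"])
        have "map_prod Some Some ((a, p), (b, q)) \<in> map_prod Some Some ` G s t"
          using t(2) by (rule imageI)
        then show "Some (s, t) \<in> V \<and> (\<alpha>, \<beta>) \<in> F (Some (s, t))"
          using s t(1) \<alpha>(1) \<beta>(1) by (auto simp: V_def F_def)
        fix v assume "v \<in> V \<and> (\<alpha>, \<beta>) \<in> F v"
        then obtain s' t' where "s' < x" "t' \<in> P" "v = Some (s', t')" "((a, p), (b, q)) \<in> G s' t'"
          using arc_cases[of v \<alpha> \<beta>] B_arc False \<alpha>(1) \<beta>(1) by blast
        moreover from this have "s' = s" using G_arc unfolding s_def by blast
        ultimately show "v = Some (s, t)" using t_unique by blast
      qed
    qed
  qed
  moreover have "finite V" using P by (simp add: V_def)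
  moreover have "card V = card {1..4 * m * x + 1}"
    unfolding V_def using P by (subst card_insert) (auto simp: card_cartesian_product)
  ultimately show ?thesis
    using finite_same_card_bij[of V "{1..4 * m * x + 1}"] near_system_transport by blast
qed

section \<open>Lifting to the tensor product\<close>

text \<open>Distinct indices give disjoint edge sets; as these are non-empty, equal edge sets force
  equal indices, whence injectivity of \<open>edges\<close>.\<close>

lemma is_ARCS_of_indexed_family:
  assumes factor: "\<And>i. i \<in> I \<Longrightarrow> partial_cycle_factor k u g (H i)"
    and sub: "\<And>i. i \<in> I \<Longrightarrow> edges (H i) \<subseteq> edges (tensor_product (complete_graph u) (complete_graph g))"
    and ne: "\<And>i. i \<in> I \<Longrightarrow> edges (H i) \<noteq> {}"
    and ex1: "\<And>e. e \<in> edges (tensor_product (complete_graph u) (complete_graph g))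
      \<Longrightarrow> \<exists>!i. i \<in> I \<and> e \<in> edges (H i)"
  shows "is_ARCS k u g (H ` I)"
proof -
  have same: "i = j" if "i \<in> I" "j \<in> I" "e \<in> edges (H i)" "e \<in> edges (H j)" for i j e
    using ex1[of e] sub that by blast
  have inj: "inj_on edges (H ` I)"
  proof (rule inj_onI)
    fix A B assume "A \<in> H ` I" "B \<in> H ` I" and eq: "edges A = edges B"
    then obtain i j where "A = H i" "B = H j" "i \<in> I" "j \<in> I" by blast
    then show "A = B" using same[of i j] ne[of i] eq by auto
  qed
  have "partition_on (edges (tensor_product (complete_graph u) (complete_graph g))) (edges ` H ` I)"
  proof (rule partition_onI)
    show "\<Union> (edges ` H ` I) = edges (tensor_product (complete_graph u) (complete_graph g))"
    proof
      show "\<Union> (edges ` H ` I) \<subseteq> edges (tensor_product (complete_graph u) (complete_graph g))"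
        using sub by blast
      show "edges (tensor_product (complete_graph u) (complete_graph g)) \<subseteq> \<Union> (edges ` H ` I)"
      proof
        fix e assume "e \<in> edges (tensor_product (complete_graph u) (complete_graph g))"
        then obtain i where "i \<in> I" "e \<in> edges (H i)" using ex1 by blast
        then show "e \<in> \<Union> (edges ` H ` I)" by blast
      qed
    qed
    fix p q assume "p \<in> edges ` H ` I" "q \<in> edges ` H ` I" "p \<noteq> q"
    then obtain i j where "p = edges (H i)" "q = edges (H j)" "i \<in> I" "j \<in> I" "i \<noteq> j" by blast
    then show "disjnt p q" using same[of i j] unfolding disjnt_def by blast
  next
    show "{} \<notin> edges ` H ` I" using ne by auto
  qed
  then show ?thesis unfolding is_ARCS_def using factor inj by blast
qed

section \<open>Edges of the tensor product and orientation of the pairs of levels\<close>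

lemma tensor_complete_edge:
  "e \<in> edges (tensor_product (complete_graph u) (complete_graph g)) \<longleftrightarrow>
    (\<exists>a s b t. e = {(a, s), (b, t)} \<and> a \<in> {1..u} \<and> b \<in> {1..u} \<and> a \<noteq> b \<and>
      s \<in> {1..g} \<and> t \<in> {1..g} \<and> s \<noteq> t)"
proof -
  have "{a, b} \<in> edges (complete_graph n) \<longleftrightarrow> a \<in> {1..n} \<and> b \<in> {1..n} \<and> a \<noteq> b" for a b n
    by (auto simp: complete_graph_def card_insert_if)
  then show ?thesis by (simp add: tensor_product_def)
qed

text \<open>Addition modulo \<open>g\<close> on the representatives \<open>1, ..., g\<close>, hence
  the test with \<open>\<le>\<close>.\<close>

definition cyclic_shift :: "nat \<Rightarrow> nat \<Rightarrow> nat \<Rightarrow> nat" where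
  "cyclic_shift g d s = (if s + d \<le> g then s + d else s + d - g)"

lemma bij_betw_cyclic_shift:
  assumes "d \<le> g"
  shows "bij_betw (cyclic_shift g d) {1..g} {1..g}"
proof -
  have "inj_on (cyclic_shift g d) {1..g}"
    by (rule inj_onI) (auto simp: cyclic_shift_def split: if_splits)
  moreover have "cyclic_shift g d ` {1..g} \<subseteq> {1..g}" using assms by (auto simp: cyclic_shift_def)
  ultimately show ?thesis by (simp add: bij_betw_def endo_inj_surj)
qed

text \<open>The two opposite differences of a pair of levels add up to the odd number
  \<open>g\<close>, so exactly one of them is at most \<open>g div 2\<close>. This orients every
  pair of levels.\<close>

lemma cyclic_tournament:
  assumes "s \<in> {1..g}" "t \<in> {1..g}" "s \<noteq> t" "odd g"
  obtains (forward) d where "d \<in> {1..g div 2}"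
      "\<And>d'. d' \<in> {1..g div 2} \<Longrightarrow> (cyclic_shift g d' s = t \<longleftrightarrow> d' = d) \<and> cyclic_shift g d' t \<noteq> s"
    | (backward) d where "d \<in> {1..g div 2}"
      "\<And>d'. d' \<in> {1..g div 2} \<Longrightarrow> (cyclic_shift g d' t = s \<longleftrightarrow> d' = d) \<and> cyclic_shift g d' s \<noteq> t"
proof -
  obtain n where n: "g = 2 * n + 1" using assms(4) by (rule oddE)
  define d where "d = (if s < t then t - s else t + g - s)"
  define d2 where "d2 = (if t < s then s - t else s + g - t)"
  have D: "d + d2 = g" "d \<ge> 1" "d2 \<ge> 1" using assms by (auto simp: d_def d2_def)
  have shift: "cyclic_shift g d' s = t \<longleftrightarrow> d' = d" "cyclic_shift g d' t = s \<longleftrightarrow> d' = d2"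
    if "d' \<le> n" "d' \<ge> 1" for d'
    using that assms n by (auto simp: cyclic_shift_def d_def d2_def)
  show thesis
  proof (cases "d \<le> n")
    case True
    then show thesis using D n shift by (intro forward[of d]) auto
  next
    case False
    then show thesis using D n shift by (intro backward[of d2]) auto
  qed
qed

theorem theorem4p2:
  fixes k x u g :: nat
  assumes "k > 0" and "k mod 4 = 0"
    and "x > 0" and "x \<noteq> 2"
    and "u = k * x + 1"
    and "g \<ge> 3" and "odd g"
  shows "\<exists>\<F>. is_ARCS k u g \<F>"
proof -
  obtain m where m: "k = 2 * (2 * m)" "m \<ge> 1"
    using assms(1,2) by (intro that[of "k div 4"]) auto
  define V where "V = {1..u}"
  define S where "S = {1..g}"
  define K where "K = tensor_product (complete_graph u) (complete_graph g)"
  obtain F where "near_system (2 * m) V F"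
    using near_system_exists[OF m(2) assms(3,4)] m(1) assms(5) by (auto simp: V_def)
  then have F: "\<And>v. v \<in> V \<Longrightarrow> anti_factor (2 * m) (V - {v}) (F v)"
    and F_ex1: "\<And>a b. a \<in> V \<Longrightarrow> b \<in> V \<Longrightarrow> a \<noteq> b \<Longrightarrow> \<exists>!v. v \<in> V \<and> (a, b) \<in> F v"
    by (auto simp: near_system_def)
  define E where "E v d = lift_arcs S (cyclic_shift g d) (F v)" for v d
  define H where "H = (\<lambda>(v, d). Graph ((V - {v}) \<times> S) (E v d))"
  \<comment> \<open>Half of the shifts suffice: \<open>(b, a)\<close> with shift
    \<open>g - d\<close> would give the same edges as \<open>(a, b)\<close> with shift
    \<open>d\<close>.\<close>
  define I where "I = V \<times> {1..g div 2}"
  have arc: "a \<in> V - {v} \<and> b \<in> V - {v} \<and> a \<noteq> b" if "v \<in> V" "(a, b) \<in> F v" for v a b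
    using anti_factor_arc[OF F[OF that(1)] that(2)] .
  have bij: "bij_betw (cyclic_shift g d) S S" if "d \<in> {1..g div 2}" for d
    unfolding S_def by (rule bij_betw_cyclic_shift) (use that in auto)
  have shift_neq: "cyclic_shift g d s \<noteq> s \<and> cyclic_shift g d s \<in> S" if "d \<in> {1..g div 2}" "s \<in> S" for d s
    using that assms(6) by (auto simp: cyclic_shift_def S_def)
  have edge: "\<exists>a s b t. e = {(a, s), (b, t)} \<and> a \<in> V - {v} \<and> b \<in> V - {v} \<and> a \<noteq> b \<and>
      s \<in> S \<and> t \<in> S \<and> s \<noteq> t" if h: "v \<in> V" "d \<in> {1..g div 2}" "e \<in> E v d" for v d e
  proof -
    obtain a b s where "e = {(a, s), (b, cyclic_shift g d s)}" "(a, b) \<in> F v" "s \<in> S"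
      using h(3) by (auto simp: E_def lift_arcs_def)
    then show ?thesis using arc[OF h(1)] shift_neq[OF h(2)] by metis
  qed
  have "is_ARCS k u g (H ` I)"
  proof (rule is_ARCS_of_indexed_family; (unfold K_def[symmetric])?)
    fix i assume "i \<in> I"
    then obtain v d where i: "i = (v, d)" "v \<in> V" "d \<in> {1..g div 2}" by (auto simp: I_def)
    have cf: "cycle_factor k ((V - {v}) \<times> S) (E v d)"
      unfolding E_def m(1) by (rule lift_anti_factor[OF F bij]) (use i m in auto)
    show sub: "edges (H i) \<subseteq> edges K"
    proof
      fix e assume "e \<in> edges (H i)"
      then have "e \<in> E v d" by (simp add: H_def i(1))
      from edge[OF i(2,3) this] show "e \<in> edges K"
        unfolding K_def tensor_complete_edge V_def S_def by blast
    qed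
    have avoid: "e \<subseteq> (V - {v}) \<times> S \<and> card e = 2" if "e \<in> E v d" for e
      using edge[OF i(2,3) that] by auto
    have "verts K = V \<times> S" by (simp add: K_def tensor_product_def complete_graph_def V_def S_def)
    then have "verts K - partite_set g v = (V - {v}) \<times> S"
      by (auto simp: partite_set_def complete_graph_def S_def)
    moreover have "e \<inter> partite_set g v = {}" if "e \<in> E v d" for e
      using avoid[OF that] by (auto simp: partite_set_def)
    ultimately have "spanning_subgraph (H i) (delete_verts K (partite_set g v))"
      using sub avoid
      by (auto simp: spanning_subgraph_def subgraph_def simple_graph_def delete_verts_def H_def i(1))
    moreover have "\<forall>C\<in>components (H i). is_cycle k C"
      using cycle_factor_components[OF cf] by (simp add: H_def i(1))
    ultimately show "partial_cycle_factor k u g (H i)"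
      unfolding partial_cycle_factor_def K_def using i(2) V_def by blast
    have "u \<ge> 2" using assms(1,3,5) by simp
    \<comment> \<open>A vertex in a part other than the omitted one, so the factor is not
      empty.\<close>
    then have "(if v = 1 then 2 else 1, 1) \<in> (V - {v}) \<times> S" using assms(6) by (simp add: V_def S_def)
    then show "edges (H i) \<noteq> {}" using cycle_factor_edges_nonempty[OF cf] by (auto simp: H_def i(1))
  next
    fix e assume "e \<in> edges K"
    then obtain a s b t where e: "e = {(a, s), (b, t)}" "a \<in> V" "b \<in> V" "a \<noteq> b" "s \<in> S" "t \<in> S" "s \<noteq> t"
      unfolding K_def tensor_complete_edge V_def S_def by blast
    \<comment> \<open>An undirected edge can arise from either of two opposite arcs.\<close>
    have mem: "e \<in> E v d \<longleftrightarrow> (a, b) \<in> F v \<and> cyclic_shift g d s = t \<or> (b, a) \<in> F v \<and> cyclic_shift g d t = s"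
      for v d
    proof -
      have "e \<in> E v d \<longleftrightarrow> (\<exists>a' b' s'. e = {(a', s'), (b', cyclic_shift g d s')} \<and> (a', b') \<in> F v \<and> s' \<in> S)"
        by (simp add: E_def lift_arcs_def)
      then show ?thesis using e(5,6) unfolding e(1) doubleton_eq_iff by auto
    qed
    obtain v where v: "v \<in> V" "\<And>v'. v' \<in> V \<Longrightarrow> (a, b) \<in> F v' \<longleftrightarrow> v' = v" using F_ex1[of a b] e by blast
    obtain w where w: "w \<in> V" "\<And>v'. v' \<in> V \<Longrightarrow> (b, a) \<in> F v' \<longleftrightarrow> v' = w" using F_ex1[of b a] e by blast
    have st: "s \<in> {1..g}" "t \<in> {1..g}" using e S_def by auto
    show "\<exists>!i. i \<in> I \<and> e \<in> edges (H i)"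
    \<comment> \<open>The orientation of \<open>s\<close> and \<open>t\<close> decides which of the
      two arcs is lifted; its factor \<open>v\<close> or \<open>w\<close> and the shift
      \<open>d\<close> are the index.\<close>
    proof (rule cyclic_tournament[OF st e(7) assms(7)])
      fix d assume "d \<in> {1..g div 2}"
        "\<And>d'. d' \<in> {1..g div 2} \<Longrightarrow> (cyclic_shift g d' s = t \<longleftrightarrow> d' = d) \<and> cyclic_shift g d' t \<noteq> s"
      then show ?thesis using v mem by (intro ex1I[of _ "(v, d)"]) (auto simp: I_def H_def)
    next
      fix d assume "d \<in> {1..g div 2}"
        "\<And>d'. d' \<in> {1..g div 2} \<Longrightarrow> (cyclic_shift g d' t = s \<longleftrightarrow> d' = d) \<and> cyclic_shift g d' s \<noteq> t"
      then show ?thesis using w mem by (intro ex1I[of _ "(w, d)"]) (auto simp: I_def H_def)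
    qed
  qed
  then show ?thesis by blast
qed

end
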